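(* Let $D=d_1,\ldots,d_n$ and $F=f_1,\ldots,f_n$ be a pair of degree and neighbor degree sequences, and let $\Delta$ denote the largest degree in $D$. Then $(D,F)$ is simple graph realizable if and only if the following integer programming feasibility problem $(\mathcal{X},\mathcal{L})$ has a solution. The set $\mathcal{X}$ consists of all variables $x_\lambda$ for all partitions $\lambda=\lambda_1,\ldots,\lambda_{h(\lambda)}$ such that $h(\lambda)\le\Delta$ and $\lambda_i\le\Delta$ for all $i$, and auxiliary variables $p_1,\ldots,p_\Delta$; $t^{i,j}_{l,k}$ for all $1\le i\le j\le\Delta$ and $1\le k,l\le\Delta$; $\tilde t^{\,i}_{l,k}$ for all $1\le i\le\Delta$ and $1\le k,l\le\Delta$; and $z_1,\ldots,z_r,b_1,\ldots,b_r$ with $r=O(\Delta^5)$. The system $\mathcal{L}$ consists of - for all $d,f$ the equation $\sum_{\lambda\dashv f\,\wedge\,h(\lambda)=d}x_\lambda=y_{d,f}$, and $x_\lambda\ge 0$ for all $\lambda$, where $y_{d,f}$ is the number of indices $i$ with $d_i=d$ and $f_i=f$; - for all $1\le i\le j\le\Delta$, the integer linear programming feasibility problem defining the recursion $$t^{i,j}_{l,k}=\max_{0\le k'\le k}\left\{t^{i,j}_{l-1,k-k'}+l\cdot\min\{k',s^{i,j}_l\}\right\},$$ and for all $i$, the integer linear programming feasibility problem defining the recursion $$\tilde t^{\,i}_{l,k}=\max_{0\le k'\le k}\left\{\tilde t^{\,i}_{l-1,k-k'}+\min\{l,k\}\cdot\min\{k',s^{i,i}_l\}\right\},$$ where $s^{i,j}_l:=\sum_{\lambda|h(\lambda)=i\,\wedge\,N(\lambda,j)=l}x_\lambda$,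 and $t^{i,j}_{l,0}=\tilde t^{\,i}_{l,0}=0$, $t^{i,j}_{0,k}=\tilde t^{\,i}_{0,k}=0$; - for all $1\le i<j\le\Delta$, the equation $$\sum_{\lambda|h(\lambda)=i}x_\lambda N(\lambda,j)=\sum_{\lambda'|h(\lambda')=j}x_{\lambda'}N(\lambda',i),$$ as well as the first $\Delta-1$ Gale–Ryser inequalities (for $1\le k\le\Delta-1$), presented as $$t^{i,j}_{i,k}\le\sum_{\lambda|h(\lambda)=j}x_\lambda\min\{k,N(\lambda,i)\};$$ - for all $i$, the equation $\sum_{\lambda|h(\lambda)=i}x_\lambda N(\lambda,i)=2p_i$, as well as the first $\Delta$ Erdős–Gallai inequalities (for $1\le k\le\Delta$), expressed as $$t^{i,i}_{i,k}\le k(k-1)+\left(\sum_{\lambda|h(\lambda)=i}x_\lambda\min\{k,N(\lambda,i)\}\right)-\tilde t^{\,i}_{i,k}.$$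
   Context: $D$ and $F$ are sequences of positive integers. $(D,F)$ is simple graph realizable if there is a simple graph on vertices $v_1,\ldots,v_n$ such that for all $k$, $d(v_k)=d_k$ and $\sum_{w\in\mathcal{N}(v_k)}d(w)=f_k$, where $d(v)$ is the degree and $\mathcal{N}(v)$ the set of neighbors of $v$. An integer programming feasibility problem $(\mathcal{X},\mathcal{L})$ consists of a set $\mathcal{X}$ of indeterminates and a linear inequality system $\mathcal{L}$ in them, and asks whether there is an integer assignment to $\mathcal{X}$ satisfying $\mathcal{L}$. $\lambda\dashv f$ means that $\lambda$ is a partition of $f$ (a multiset of positive integers with sum $f$); its height $h(\lambda)$ is its number of parts; $N(\lambda,j)$ is the number of parts equal to $j$. In the recursions, the second lower index $k$ is the running index of the recursion. The variables $z,b$ are used to express minima and maxima linearly: if $M$ is an integer with $M\ge|x-y|$, then $z=\min\{x,y\}$ is expressed by $z\le x$, $z\le y$, $z\ge x-Mb$, $z\ge y-M(1-b)$, $0\le b\le 1$, and $z=\max\{x,y\}$ by $z\ge x$, $z\ge y$, $z\le x+Mb$, $z\le y+M(1-b)$, $0\le b\le 1$, in integers.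
   Formalization: In the recursion for t̃, the k in the weight min{l,k} is kept fixed at the Erdős–Gallai parameter while the second lower index runs (intermediate values are z-variables); with k running in the weight too, the claim fails, e.g. for in-class degrees 5,4,3,2,1,1. *)

theory Defs
  imports
    Complex_Main
    "HOL-Library.Multiset"
    "HOL-Library.Poly_Mapping"
    "HOL-Library.Product_Plus"
    "HOL-Library.Landau_Symbols"
begin

definition simple_graph :: "nat \<Rightarrow> nat set set \<Rightarrow> bool" where
  "simple_graph n E \<longleftrightarrow> (\<forall>e\<in>E. e \<subseteq> {..<n} \<and> card e = 2)"

definition neighbors :: "nat set set \<Rightarrow> nat \<Rightarrow> nat set" where
  "neighbors E v = {w. {v, w} \<in> E}"

definition degree :: "nat set set \<Rightarrow> nat \<Rightarrow> nat" where
  "degree E v = card (neighbors E v)"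

definition simple_graph_realizable :: "nat list \<Rightarrow> nat list \<Rightarrow> bool" where
  "simple_graph_realizable D F \<longleftrightarrow>
     (\<exists>E. simple_graph (length D) E \<and>
          (\<forall>v<length D. degree E v = D ! v \<and> (\<Sum>w\<in>neighbors E v. degree E w) = F ! v))"

text \<open>The pair \<open>(a, c)\<close> is the inequality \<open>(\<Sum>v. a v * v) \<le> c\<close>.\<close>
type_synonym 'v lin_ineq = "('v \<Rightarrow>\<^sub>0 int) \<times> int"

type_synonym 'v int_program = "'v set \<times> 'v lin_ineq set"

definition ip_problem :: "'v int_program \<Rightarrow> bool" where
  "ip_problem P \<longleftrightarrow> finite (fst P) \<and> finite (snd P) \<and>
     (\<forall>(a, c)\<in>snd P. Poly_Mapping.keys a \<subseteq> fst P)"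

definition ip_feasible :: "'v int_program \<Rightarrow> bool" where
  "ip_feasible P \<longleftrightarrow>
     (\<exists>\<sigma> :: 'v \<Rightarrow> int. \<forall>(a, c)\<in>snd P. (\<Sum>v\<in>fst P. Poly_Mapping.lookup a v * \<sigma> v) \<le> c)"

text \<open>The pair \<open>(a, c)\<close> is the affine expression \<open>(\<Sum>v. a v * v) + c\<close>; addition, subtraction and
  finite sums of expressions are those of the product type.\<close>
type_synonym 'v lin_exp = "('v \<Rightarrow>\<^sub>0 int) \<times> int"

definition Var :: "'v \<Rightarrow> 'v lin_exp" where
  "Var v = (Poly_Mapping.single v 1, 0)"

definition Const :: "int \<Rightarrow> 'v lin_exp" where
  "Const c = (0, c)"

definition Scale :: "int \<Rightarrow> 'v lin_exp \<Rightarrow> 'v lin_exp" where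
  "Scale c e = (frag_cmul c (fst e), c * snd e)"

definition leq :: "'v lin_exp \<Rightarrow> 'v lin_exp \<Rightarrow> 'v lin_ineq" where
  "leq e e' = (fst e - fst e', snd e' - snd e)"

definition equ :: "'v lin_exp \<Rightarrow> 'v lin_exp \<Rightarrow> 'v lin_ineq set" where
  "equ e e' = {leq e e', leq e' e}"

text \<open>In integers, \<open>min_constraints\<close> and \<open>max_constraints\<close> say that \<open>z\<close> is the minimum
  (maximum) of \<open>x\<close> and \<open>y\<close>, provided \<open>M \<ge> \<bar>x - y\<bar>\<close>. In the program below, for \<open>n\<close> vertices and
  maximum degree \<open>\<Delta>\<close>, \<open>M = n + \<Delta>\<^sup>2\<close> is large enough: \<open>0 \<le> s \<le> n\<close>, \<open>k' \<le> \<Delta>\<close>, and the values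
  compared in the recursions lie between \<open>0\<close> and \<open>l * k \<le> \<Delta>\<^sup>2\<close>.\<close>
definition min_constraints ::
    "int \<Rightarrow> 'v lin_exp \<Rightarrow> 'v lin_exp \<Rightarrow> 'v lin_exp \<Rightarrow> 'v lin_exp \<Rightarrow> 'v lin_ineq set" where
  "min_constraints M z b x y =
     {leq z x, leq z y, leq (x - Scale M b) z, leq (y - Scale M (Const 1 - b)) z,
      leq (Const 0) b, leq b (Const 1)}"

definition max_constraints ::
    "int \<Rightarrow> 'v lin_exp \<Rightarrow> 'v lin_exp \<Rightarrow> 'v lin_exp \<Rightarrow> 'v lin_exp \<Rightarrow> 'v lin_ineq set" where
  "max_constraints M z b x y =
     {leq x z, leq y z, leq z (x + Scale M b), leq z (y + Scale M (Const 1 - b)),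
      leq (Const 0) b, leq b (Const 1)}"

text \<open>\<open>max_chain M z b c k\<close> makes \<open>z k\<close> the maximum of \<open>c 0, \<dots>, c k\<close> (for \<open>k \<ge> 1\<close>):
  \<open>z m\<close> is the maximum of \<open>c 0, \<dots>, c m\<close>.\<close>
definition max_chain ::
    "int \<Rightarrow> (nat \<Rightarrow> 'v lin_exp) \<Rightarrow> (nat \<Rightarrow> 'v lin_exp) \<Rightarrow> (nat \<Rightarrow> 'v lin_exp) \<Rightarrow> nat \<Rightarrow>
     'v lin_ineq set" where
  "max_chain M z b c k =
     (\<Union>m\<in>{1..k}. max_constraints M (z m) (b m) (if m = 1 then c 0 else z (m - 1)) (c m))"

text \<open>A partition is a multiset of positive integers; its height is its \<open>size\<close>, and
  \<open>N(\<mu>,j)\<close> is \<open>count \<mu> j\<close>.\<close>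

definition partitions :: "nat \<Rightarrow> nat multiset set" where
  "partitions \<Delta> = {\<mu>. size \<mu> \<le> \<Delta> \<and> (\<forall>a\<in>#\<mu>. 1 \<le> a \<and> a \<le> \<Delta>)}"

definition partitions_height :: "nat \<Rightarrow> nat \<Rightarrow> nat multiset set" where
  "partitions_height \<Delta> i = {\<mu> \<in> partitions \<Delta>. size \<mu> = i}"

text \<open>Names of the minima and maxima. Each one has its own variables \<open>z\<close> and \<open>b\<close>.
  \<open>Min_s i j l k'\<close> stands for the minimum of \<open>k'\<close> and \<open>s\<^sup>i\<^sup>j\<^sub>l\<close>, and \<open>Max_t i j l k m\<close> for the
  maximum over \<open>k' \<le> m\<close> in the recursion for \<open>t\<^sup>i\<^sup>j\<^sub>l\<^sub>k\<close>.

  The second family of recursion variables (t with a tilde) is written \<open>tt\<close>.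
  In its recursion, the letter \<open>k\<close> in the weight \<open>min {l, k}\<close> is the parameter of
  the Erdos-Gallai inequality in which the result is used: it keeps its value while the second
  lower index runs. (If it decreased along with the running index, the inequalities would not be
  the Erdos-Gallai inequalities: the non-graphical sequence 5,4,3,2,1,1 would satisfy them all.)
  So \<open>Max_tt i k l q m\<close> is the maximum over \<open>k' \<le> m\<close> at lower indices \<open>l, q\<close> (\<open>q \<le> k\<close>) of the
  recursion started at second lower index \<open>k\<close>.\<close>
datatype aux =
    Min_s nat nat nat nat
  | Max_t nat nat nat nat nat
  | Max_tt nat nat nat nat nat

datatype ip_var =
    x_var "nat multiset"
  | p_var nat
  | t_var nat nat nat nat
  | tt_var nat nat nat
  | z_var aux
  | b_var aux

definition aux_names :: "nat \<Rightarrow> aux set" where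
  "aux_names \<Delta> =
     {Min_s i j l k' | i j l k'. 1 \<le> i \<and> i \<le> j \<and> j \<le> \<Delta> \<and> 1 \<le> l \<and> l \<le> \<Delta> \<and> k' \<le> \<Delta>} \<union>
     {Max_t i j l k m | i j l k m. 1 \<le> i \<and> i \<le> j \<and> j \<le> \<Delta> \<and> 1 \<le> l \<and> l \<le> \<Delta> \<and>
        k \<le> \<Delta> \<and> 1 \<le> m \<and> m \<le> k} \<union>
     {Max_tt i k l q m | i k l q m. 1 \<le> i \<and> i \<le> \<Delta> \<and> k \<le> \<Delta> \<and> 1 \<le> l \<and> l \<le> \<Delta> \<and>
        q \<le> k \<and> 1 \<le> m \<and> m \<le> q}"

definition ip_vars :: "nat \<Rightarrow> ip_var set" where
  "ip_vars \<Delta> =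
     x_var ` partitions \<Delta> \<union>
     p_var ` {1..\<Delta>} \<union>
     {t_var i j l k | i j l k. 1 \<le> i \<and> i \<le> j \<and> j \<le> \<Delta> \<and> l \<in> {1..\<Delta>} \<and> k \<in> {1..\<Delta>}} \<union>
     {tt_var i l k | i l k. i \<in> {1..\<Delta>} \<and> l \<in> {1..\<Delta>} \<and> k \<in> {1..\<Delta>}} \<union>
     z_var ` aux_names \<Delta> \<union>
     b_var ` aux_names \<Delta>"

definition x_exp :: "nat multiset \<Rightarrow> ip_var lin_exp" where
  "x_exp \<mu> = Var (x_var \<mu>)"

abbreviation Z :: "aux \<Rightarrow> ip_var lin_exp" where
  "Z a \<equiv> Var (z_var a)"

abbreviation B :: "aux \<Rightarrow> ip_var lin_exp" where
  "B a \<equiv> Var (b_var a)"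

definition t_exp :: "nat \<Rightarrow> nat \<Rightarrow> nat \<Rightarrow> nat \<Rightarrow> ip_var lin_exp" where
  "t_exp i j l k = (if l = 0 \<or> k = 0 then Const 0 else Var (t_var i j l k))"

definition tt_exp :: "nat \<Rightarrow> nat \<Rightarrow> nat \<Rightarrow> ip_var lin_exp" where
  "tt_exp i l k = (if l = 0 \<or> k = 0 then Const 0 else Var (tt_var i l k))"

text \<open>The value at lower indices \<open>l, q\<close> in the recursion for \<open>tt\<close> with weights
  \<open>min {l, k}\<close>; it is \<open>tt\<^sup>i\<^sub>l\<^sub>k\<close> for \<open>q = k\<close>.\<close>
definition tt_run :: "nat \<Rightarrow> nat \<Rightarrow> nat \<Rightarrow> nat \<Rightarrow> ip_var lin_exp" where
  "tt_run i k l q =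
     (if l = 0 \<or> q = 0 then Const 0 else if q = k then tt_exp i l k else Z (Max_tt i k l q q))"

definition s_exp :: "nat \<Rightarrow> nat \<Rightarrow> nat \<Rightarrow> nat \<Rightarrow> ip_var lin_exp" where
  "s_exp \<Delta> i j l = (\<Sum>\<mu> | \<mu> \<in> partitions_height \<Delta> i \<and> count \<mu> j = l. x_exp \<mu>)"

definition degree_constraints :: "nat \<Rightarrow> nat list \<Rightarrow> nat list \<Rightarrow> ip_var lin_ineq set" where
  "degree_constraints \<Delta> D F =
     (\<Union>d. \<Union>f. equ (\<Sum>\<mu> | \<mu> \<in> partitions_height \<Delta> d \<and> sum_mset \<mu> = f. x_exp \<mu>)
                 (Const (int (card {i. i < length D \<and> D ! i = d \<and> F ! i = f})))) \<union>
     (\<Union>\<mu>\<in>partitions \<Delta>. {leq (Const 0) (x_exp \<mu>)})"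

definition min_recursion_constraints :: "int \<Rightarrow> nat \<Rightarrow> ip_var lin_ineq set" where
  "min_recursion_constraints M \<Delta> =
     (\<Union>j\<in>{1..\<Delta>}. \<Union>i\<in>{1..j}. \<Union>l\<in>{1..\<Delta>}. \<Union>k'\<in>{0..\<Delta>}.
        min_constraints M (Z (Min_s i j l k')) (B (Min_s i j l k')) (Const (int k')) (s_exp \<Delta> i j l))"

definition t_constraints :: "int \<Rightarrow> nat \<Rightarrow> ip_var lin_ineq set" where
  "t_constraints M \<Delta> =
     (\<Union>j\<in>{1..\<Delta>}. \<Union>i\<in>{1..j}. \<Union>l\<in>{1..\<Delta>}. \<Union>k\<in>{1..\<Delta>}.
        max_chain M (\<lambda>m. Z (Max_t i j l k m)) (\<lambda>m. B (Max_t i j l k m))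
          (\<lambda>k'. t_exp i j (l - 1) (k - k') + Scale (int l) (Z (Min_s i j l k'))) k \<union>
        equ (t_exp i j l k) (Z (Max_t i j l k k)))"

definition tt_constraints :: "int \<Rightarrow> nat \<Rightarrow> ip_var lin_ineq set" where
  "tt_constraints M \<Delta> =
     (\<Union>i\<in>{1..\<Delta>}. \<Union>k\<in>{1..\<Delta>}. \<Union>l\<in>{1..\<Delta>}. \<Union>q\<in>{1..k}.
        max_chain M (\<lambda>m. Z (Max_tt i k l q m)) (\<lambda>m. B (Max_tt i k l q m))
          (\<lambda>k'. tt_run i k (l - 1) (q - k') + Scale (int (min l k)) (Z (Min_s i i l k'))) q \<union>
        equ (tt_run i k l q) (Z (Max_tt i k l q q)))"

definition gale_ryser_constraints :: "nat \<Rightarrow> ip_var lin_ineq set" where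
  "gale_ryser_constraints \<Delta> =
     (\<Union>j\<in>{1..\<Delta>}. \<Union>i\<in>{1..<j}.
        equ (\<Sum>\<mu>\<in>partitions_height \<Delta> i. Scale (int (count \<mu> j)) (x_exp \<mu>))
            (\<Sum>\<mu>\<in>partitions_height \<Delta> j. Scale (int (count \<mu> i)) (x_exp \<mu>)) \<union>
        (\<Union>k\<in>{1..\<Delta> - 1}.
           {leq (t_exp i j i k)
                (\<Sum>\<mu>\<in>partitions_height \<Delta> j. Scale (int (min k (count \<mu> i))) (x_exp \<mu>))}))"

definition erdos_gallai_constraints :: "nat \<Rightarrow> ip_var lin_ineq set" where
  "erdos_gallai_constraints \<Delta> =
     (\<Union>i\<in>{1..\<Delta>}.
        equ (\<Sum>\<mu>\<in>partitions_height \<Delta> i. Scale (int (count \<mu> i)) (x_exp \<mu>))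
            (Scale 2 (Var (p_var i))) \<union>
        (\<Union>k\<in>{1..\<Delta>}.
           {leq (t_exp i i i k)
                (Const (int k * (int k - 1)) +
                 (\<Sum>\<mu>\<in>partitions_height \<Delta> i. Scale (int (min k (count \<mu> i))) (x_exp \<mu>)) -
                 tt_exp i i k)}))"

definition realization_ip :: "int \<Rightarrow> nat \<Rightarrow> nat list \<Rightarrow> nat list \<Rightarrow> ip_var int_program" where
  "realization_ip M \<Delta> D F =
     (ip_vars \<Delta>,
      degree_constraints \<Delta> D F \<union> min_recursion_constraints M \<Delta> \<union> t_constraints M \<Delta> \<union>
      tt_constraints M \<Delta> \<union> gale_ryser_constraints \<Delta> \<union> erdos_gallai_constraints \<Delta>)"

end

theory Submission
  imports Defs
begin

text \<open>A vertex \<open>v\<close> of a graph sees a partition \<open>\<mu> v\<close>: the multiset of the degrees of its neighbors.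
Its size is the degree of \<open>v\<close> and its sum is the neighbor degree of \<open>v\<close>. The value of \<open>x_var \<pi>\<close>
is meant to be the number of vertices with \<open>\<mu> v = \<pi>\<close>.

Once \<open>\<mu>\<close> is prescribed, the question whether a graph with these local partitions exists splits
into independent questions, one for each pair of degrees \<open>i \<le> j\<close>. The edges between the vertices of
degree \<open>i\<close> and those of degree \<open>j\<close> form a bipartite graph (a simple graph if \<open>i = j\<close>) in which
the degree of \<open>v\<close> is the number of entries \<open>j\<close>, respectively \<open>i\<close>, of \<open>\<mu> v\<close>; conversely, any
choice of such graphs can be superimposed, because no two of them share a possible edge
(\<open>realizable_imp_local_partitions\<close>, \<open>local_partitions_imp_realizable\<close>). The theorems of Gale and
Ryser (\<open>gale_ryser\<close>) and of Erdos and Gallai (\<open>erdos_gallai\<close>) decide these questions by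
inequalities about arbitrary sets \<open>S\<close> of vertices.

For every cardinality \<open>k\<close> the strongest inequality comes from the \<open>k\<close> vertices of largest degree,
and the recursions of the program compute the corresponding maximal sums (\<open>greedy\<close>) from the
numbers of vertices of each degree alone. In the Erdos-Gallai inequality two such sums occur, one of
degrees \<open>d v\<close> and one of truncated degrees \<open>min k (d v)\<close>; they may be maximized independently,
because a set of \<open>k\<close> vertices of largest degree maximizes both (\<open>greedy_common_optimum\<close>).
Only parameters \<open>k\<close> up to \<open>\<Delta>\<close> matter, since the inequalities for larger ones follow from the
degree bound and, in the bipartite case, the equality of the two degree sums.

Hence realizability depends only on the numbers \<open>x \<pi>\<close>, and the condition on them is the predicate
\<open>solves\<close> (\<open>realizable_iff_solves\<close>); numbers that satisfy the equations for all pairs of degree and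
neighbor degree come from some \<open>\<mu>\<close> (\<open>ex_assignment_with_fibres\<close>). It remains to see that the linear
system expresses \<open>solves\<close>. In every solution the auxiliary variables are forced to be the minima,
the maxima and the \<open>greedy\<close> values that they stand for (\<open>satisfies_imp_solves\<close>). Conversely these
values solve the system as soon as \<open>M\<close> bounds all differences of compared numbers
(\<open>solves_imp_satisfies\<close>).\<close>

section \<open>Degrees under changes of single edges\<close>

definition graph_on :: "nat set \<Rightarrow> nat set set \<Rightarrow> bool" where
  "graph_on V E \<longleftrightarrow> (\<forall>e\<in>E. e \<subseteq> V \<and> card e = 2)"

definition bipartite_on :: "nat set \<Rightarrow> nat set \<Rightarrow> nat set set \<Rightarrow> bool" where
  "bipartite_on X Y E \<longleftrightarrow> (\<forall>e\<in>E. \<exists>x\<in>X. \<exists>y\<in>Y. e = {x, y})"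

definition graphic :: "nat set \<Rightarrow> (nat \<Rightarrow> nat) \<Rightarrow> bool" where
  "graphic V d \<longleftrightarrow> (\<exists>E. graph_on V E \<and> (\<forall>v\<in>V. degree E v = d v))"

definition bigraphic :: "nat set \<Rightarrow> nat set \<Rightarrow> (nat \<Rightarrow> nat) \<Rightarrow> (nat \<Rightarrow> nat) \<Rightarrow> bool" where
  "bigraphic X Y a b \<longleftrightarrow>
     (\<exists>E. bipartite_on X Y E \<and> (\<forall>x\<in>X. degree E x = a x) \<and> (\<forall>y\<in>Y. degree E y = b y))"

lemma neighbors_sym: "w \<in> neighbors E v \<longleftrightarrow> v \<in> neighbors E w"
  by (simp add: neighbors_def insert_commute)

lemma graph_on_neighbors:
  assumes "graph_on V E"
  shows "neighbors E v \<subseteq> V - {v}"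
  using assms by (fastforce simp: graph_on_def neighbors_def)

lemma graph_on_edge:
  assumes "graph_on V E" "{a, b} \<in> E"
  shows "a \<in> V" "b \<in> V" "a \<noteq> b"
  using assms by (fastforce simp: graph_on_def)+

lemma graph_on_finite:
  assumes "graph_on V E" "finite V"
  shows "finite E" "finite (neighbors E v)"
proof -
  show "finite E"
    by (rule finite_subset[of _ "Pow V"]) (use assms in \<open>auto simp: graph_on_def\<close>)
  show "finite (neighbors E v)"
    using graph_on_neighbors[OF assms(1)] assms(2) by (meson finite_Diff finite_subset)
qed

lemma graph_on_insert:
  assumes "graph_on V E" "a \<in> V" "b \<in> V" "a \<noteq> b"
  shows "graph_on V (insert {a, b} E)"
  using assms by (auto simp: graph_on_def)

lemma graph_on_Diff: "graph_on V E \<Longrightarrow> graph_on V (E - A)"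
  by (auto simp: graph_on_def)

lemma degree_insert_edge:
  assumes "finite (neighbors E u)" "a \<noteq> b" "{a, b} \<notin> E"
  shows "degree (insert {a, b} E) u = degree E u + of_bool (u = a) + of_bool (u = b)"
proof -
  have "neighbors (insert {a, b} E) u =
      (if u = a then insert b (neighbors E u) else if u = b then insert a (neighbors E u)
       else neighbors E u)"
    by (auto simp: neighbors_def doubleton_eq_iff)
  moreover have "b \<notin> neighbors E a" "a \<notin> neighbors E b"
    using assms(3) by (auto simp: neighbors_def insert_commute)
  ultimately show ?thesis
    using assms(1,2) by (auto simp: degree_def)
qed

lemma degree_remove_edge:
  assumes "finite (neighbors E u)" "a \<noteq> b" "{a, b} \<in> E"
  shows "degree (E - {{a, b}}) u + of_bool (u = a) + of_bool (u = b) = degree E u"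
proof -
  have "neighbors (E - {{a, b}}) u \<subseteq> neighbors E u"
    by (auto simp: neighbors_def)
  then have "finite (neighbors (E - {{a, b}}) u)"
    using assms(1) by (rule finite_subset)
  then have "degree (insert {a, b} (E - {{a, b}})) u =
      degree (E - {{a, b}}) u + of_bool (u = a) + of_bool (u = b)"
    by (intro degree_insert_edge) (use assms(2) in auto)
  then show ?thesis
    using assms(3) by (simp add: insert_absorb)
qed

text \<open>Both sides count the edges between \<open>S\<close> and \<open>T\<close> (edges inside \<open>S \<inter> T\<close> twice).\<close>

lemma edges_between_commute:
  assumes "finite S" "finite T"
  shows "(\<Sum>v\<in>S. card (neighbors E v \<inter> T)) = (\<Sum>w\<in>T. card (neighbors E w \<inter> S))"
proof -
  have card: "card (neighbors E v \<inter> C) = (\<Sum>w\<in>C. of_bool ({v, w} \<in> E))" if "finite C" for v C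
  proof -
    have "neighbors E v \<inter> C = C \<inter> {w. {v, w} \<in> E}"
      by (auto simp: neighbors_def)
    then show ?thesis
      using that by (simp add: sum.If_cases of_bool_def)
  qed
  have "(\<Sum>v\<in>S. card (neighbors E v \<inter> T)) = (\<Sum>w\<in>T. \<Sum>v\<in>S. of_bool ({v, w} \<in> E))"
    by (subst sum.swap) (simp add: card assms)
  then show ?thesis
    by (simp add: card assms insert_commute)
qed

lemma card_neighbors_split:
  assumes "finite (neighbors E v)"
  shows "degree E v = card (neighbors E v \<inter> A) + card (neighbors E v - A)"
  using assms unfolding degree_def
  by (metis Int_Diff_Un Int_Diff_disjoint card_Un_disjoint finite_Diff finite_Int)

lemma handshake:
  assumes "finite V" "graph_on V E"
  shows "even (\<Sum>v\<in>V. degree E v)"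
proof -
  have "finite E"
    using assms graph_on_finite by blast
  then show ?thesis
    using assms(2)
  proof (induction E)
    case empty
    then show ?case by (simp add: degree_def neighbors_def)
  next
    case (insert e E)
    have gE: "graph_on V E" and e: "e \<subseteq> V" "card e = 2"
      using insert.prems by (auto simp: graph_on_def)
    then obtain a b where ab: "e = {a, b}" "a \<noteq> b"
      by (meson card_2_iff)
    have "(\<Sum>v\<in>V. degree (insert e E) v) = (\<Sum>v\<in>V. degree E v + of_bool (v = a) + of_bool (v = b))"
      using ab insert.hyps(2) graph_on_finite(2)[OF gE assms(1)] degree_insert_edge by auto
    also have "\<dots> = (\<Sum>v\<in>V. degree E v) + 2"
    proof -
      have "V \<inter> {v. v = a} = {a}" "V \<inter> {v. v = b} = {b}"
        using e ab by auto
      then show ?thesis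
        using assms(1) e ab by (simp add: sum.distrib sum.If_cases of_bool_def)
    qed
    finally show ?case
      using insert.IH[OF gE] by simp
  qed
qed

text \<open>The source of all edge exchanges below: if \<open>i\<close> has larger degree than \<open>r\<close>, an edge \<open>{u, i}\<close> can
be rerouted to the new edge \<open>{u, r}\<close>, which raises the degree of \<open>r\<close> and lowers only that of \<open>i\<close>.
If \<open>i\<close> and \<open>r\<close> are adjacent, \<open>i\<close> itself is a neighbor of \<open>r\<close> but not of \<open>i\<close>, so the strict
inequality still leaves a neighbor \<open>u \<noteq> r\<close> of \<open>i\<close>.\<close>

lemma private_neighbor:
  assumes "finite (neighbors E r)" "degree E r < degree E i" "i \<noteq> r"
    and "i \<notin> neighbors E i"
  obtains u where "{u, i} \<in> E" "{u, r} \<notin> E" "u \<noteq> r"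
proof -
  have "\<exists>u. u \<in> neighbors E i \<and> u \<notin> neighbors E r \<and> u \<noteq> r"
  proof (rule ccontr)
    assume "\<not> ?thesis"
    then have sub: "neighbors E i \<subseteq> insert r (neighbors E r)" by blast
    have "card (neighbors E i) \<le> card (neighbors E r)"
    proof (cases "i \<in> neighbors E r")
      case True
      then have "neighbors E i \<subseteq> insert r (neighbors E r - {i})"
        using sub assms(4) by blast
      then have "card (neighbors E i) \<le> card (insert r (neighbors E r - {i}))"
        using assms(1) by (intro card_mono) auto
      also have "\<dots> \<le> Suc (card (neighbors E r - {i}))"
        using assms(1) by (simp add: card_insert_le_m1 card_insert_if)
      also have "\<dots> = card (neighbors E r)"
        using True assms(1) by (metis card_Suc_Diff1)
      finally show ?thesis .
    next
      case False
      then have "neighbors E i \<subseteq> neighbors E r"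
        using sub neighbors_sym by blast
      then show ?thesis
        using assms(1) by (rule card_mono[rotated])
    qed
    then show False
      using assms(2) by (simp add: degree_def)
  qed
  then show thesis
    using that by (auto simp: neighbors_def insert_commute)
qed

text \<open>Sets built by adding elements in the order of decreasing \<open>d\<close>. Ties are broken arbitrarily, which
avoids sorting.\<close>

lemma top_subset_induct:
  fixes d :: "'a \<Rightarrow> nat"
  assumes "finite V" "P {}" and "m \<le> card V"
    and step: "\<And>R r. \<lbrakk>R \<subseteq> V; r \<in> V - R; \<forall>v\<in>R. d r \<le> d v; P R\<rbrakk> \<Longrightarrow> P (insert r R)"
  shows "\<exists>R\<subseteq>V. card R = m \<and> (\<forall>v\<in>R. \<forall>w\<in>V - R. d w \<le> d v) \<and> P R"
  using assms(3)
proof (induction m)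
  case 0
  then show ?case using assms(2) by (intro exI[of _ "{}"]) auto
next
  case (Suc m)
  then obtain R where R: "R \<subseteq> V" "card R = m" "\<forall>v\<in>R. \<forall>w\<in>V - R. d w \<le> d v" "P R"
    by auto
  have fR: "finite R"
    using R(1) assms(1) finite_subset by blast
  have "V - R \<noteq> {}"
    using R(2) Suc.prems R(1) by auto
  then obtain r where r: "r \<in> V - R" "\<forall>w\<in>V - R. d w \<le> d r"
    using assms(1) Max_in[of "d ` (V - R)"] Max_ge[of "d ` (V - R)"] by fastforce
  have "P (insert r R)"
    using step[of R r] R r by blast
  then show ?case
    using R r fR by (intro exI[of _ "insert r R"]) auto
qed

lemma saturating_induct:
  fixes d :: "'a \<Rightarrow> nat"
  assumes "finite V" "P {}"
    and step: "\<And>R r. \<lbrakk>R \<subseteq> V; r \<in> V - R; \<forall>v\<in>R. d r \<le> d v; P R\<rbrakk> \<Longrightarrow> P (insert r R)"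
  shows "P V"
proof -
  obtain R where R: "R \<subseteq> V" "card R = card V" "P R"
    using top_subset_induct[OF assms(1,2) le_refl step] by blast
  then show ?thesis
    using card_subset_eq[OF assms(1) R(1,2)] by simp
qed

section \<open>The theorem of Gale and Ryser\<close>

lemma bipartite_onD:
  assumes "bipartite_on X Y E" "X \<inter> Y = {}" "{a, b} \<in> E" "a \<in> X"
  shows "b \<in> Y"
proof -
  obtain x y where xy: "x \<in> X" "y \<in> Y" "{a, b} = {x, y}"
    using assms(1,3) by (auto simp: bipartite_on_def)
  then show ?thesis
    using assms(2,4) by (auto simp: doubleton_eq_iff)
qed

lemma bipartite_on_sym: "bipartite_on X Y E \<longleftrightarrow> bipartite_on Y X E"
proof -
  have "(\<exists>x\<in>X. \<exists>y\<in>Y. e = {x, y}) \<longleftrightarrow> (\<exists>y\<in>Y. \<exists>x\<in>X. e = {y, x})" for e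
    by (metis insert_commute)
  then show ?thesis
    unfolding bipartite_on_def by simp
qed

lemma bipartite_on_graph_on:
  assumes "bipartite_on X Y E" "X \<inter> Y = {}"
  shows "graph_on (X \<union> Y) E"
proof -
  have "e \<subseteq> X \<union> Y \<and> card e = 2" if "e \<in> E" for e
  proof -
    obtain x y where "x \<in> X" "y \<in> Y" "e = {x, y}"
      using assms(1) \<open>e \<in> E\<close> by (auto simp: bipartite_on_def)
    moreover from this have "x \<noteq> y"
      using assms(2) by blast
    ultimately show ?thesis
      by simp
  qed
  then show ?thesis by (simp add: graph_on_def)
qed

lemma bipartite_on_neighbors:
  assumes "bipartite_on X Y E" "X \<inter> Y = {}"
  shows "x \<in> X \<Longrightarrow> neighbors E x \<subseteq> Y" and "y \<in> Y \<Longrightarrow> neighbors E y \<subseteq> X"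
proof -
  show "x \<in> X \<Longrightarrow> neighbors E x \<subseteq> Y"
    using bipartite_onD[OF assms] by (auto simp: neighbors_def)
  have "bipartite_on Y X E" "Y \<inter> X = {}"
    using assms bipartite_on_sym by blast+
  then show "y \<in> Y \<Longrightarrow> neighbors E y \<subseteq> X"
    using bipartite_onD[of Y X E] by (auto simp: neighbors_def)
qed

text \<open>Every vertex of \<open>Y\<close> sends at most \<open>min k (b y)\<close> edges into a set of at most \<open>k\<close> vertices.\<close>

lemma gale_ryser_necessary:
  assumes fin: "finite X" "finite Y" and "X \<inter> Y = {}" and "bigraphic X Y a b"
  shows "(\<Sum>x\<in>X. a x) = (\<Sum>y\<in>Y. b y)"
    and "S \<subseteq> X \<Longrightarrow> card S \<le> k \<Longrightarrow> (\<Sum>x\<in>S. a x) \<le> (\<Sum>y\<in>Y. min k (b y))"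
proof -
  obtain E where E: "bipartite_on X Y E"
    and a: "\<And>x. x \<in> X \<Longrightarrow> degree E x = a x" and b: "\<And>y. y \<in> Y \<Longrightarrow> degree E y = b y"
    using assms(4) by (auto simp: bigraphic_def)
  have finN: "finite (neighbors E v)" for v
    using graph_on_finite(2)[OF bipartite_on_graph_on[OF E assms(3)]] fin by blast
  have deg_X: "card (neighbors E x \<inter> Y) = a x" if "x \<in> X" for x
    using bipartite_on_neighbors(1)[OF E assms(3) that] a[OF that] by (simp add: degree_def Int_absorb2)
  have deg_Y: "card (neighbors E y \<inter> X) = b y" if "y \<in> Y" for y
    using bipartite_on_neighbors(2)[OF E assms(3) that] b[OF that]
    by (simp add: degree_def Int_absorb2)
  show "(\<Sum>x\<in>X. a x) = (\<Sum>y\<in>Y. b y)"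
    using edges_between_commute[OF fin, of E] deg_X deg_Y by simp
  show "(\<Sum>x\<in>S. a x) \<le> (\<Sum>y\<in>Y. min k (b y))" if S: "S \<subseteq> X" "card S \<le> k"
  proof -
    have finS: "finite S"
      using S(1) fin(1) by (rule finite_subset)
    have "(\<Sum>x\<in>S. a x) = (\<Sum>x\<in>S. card (neighbors E x \<inter> Y))"
      using S(1) deg_X by (intro sum.cong) auto
    also have "\<dots> = (\<Sum>y\<in>Y. card (neighbors E y \<inter> S))"
      using finS fin(2) by (rule edges_between_commute)
    also have "\<dots> \<le> (\<Sum>y\<in>Y. min k (b y))"
    proof (intro sum_mono min.boundedI)
      fix y assume "y \<in> Y"
      show "card (neighbors E y \<inter> S) \<le> k"
        using S(2) card_mono[OF finS, of "neighbors E y \<inter> S"] by simp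
      have "neighbors E y \<inter> S \<subseteq> neighbors E y \<inter> X"
        using S(1) by blast
      then show "card (neighbors E y \<inter> S) \<le> b y"
        using finN deg_Y[OF \<open>y \<in> Y\<close>] card_mono by (metis finite_Int)
    qed
    finally show ?thesis .
  qed
qed

text \<open>The vertices of \<open>X\<close> are saturated one after the other, in the order of decreasing \<open>a\<close>, while the
degrees in \<open>Y\<close> stay below \<open>b\<close>. Among all graphs in which \<open>R\<close> is saturated and, in the rest of \<open>X\<close>,
only \<open>r\<close> has edges, one with the largest degree of \<open>r\<close> saturates \<open>r\<close>: otherwise no exchange can raise the degree
of \<open>r\<close>, which forces every \<open>y\<close> to have degree \<open>min (card (insert r R)) (b y)\<close>. Counting the edges at
\<open>insert r R\<close> then contradicts the Gale-Ryser inequality for this set.\<close>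

lemma gale_ryser_step:
  assumes fin: "finite X" "finite Y" and disj: "X \<inter> Y = {}"
    and R: "R \<subseteq> X" "r \<in> X - R" "\<forall>v\<in>R. a r \<le> a v"
    and GR: "(\<Sum>x\<in>insert r R. a x) \<le> (\<Sum>y\<in>Y. min (card (insert r R)) (b y))"
    and E0: "bipartite_on X Y E0" "\<forall>x\<in>R. degree E0 x = a x" "\<forall>x\<in>X - R. degree E0 x = 0"
      "\<forall>y\<in>Y. degree E0 y \<le> b y"
  shows "\<exists>E. bipartite_on X Y E \<and> (\<forall>x\<in>insert r R. degree E x = a x) \<and>
    (\<forall>x\<in>X - insert r R. degree E x = 0) \<and> (\<forall>y\<in>Y. degree E y \<le> b y)"
proof -
  define P where "P E \<longleftrightarrow> bipartite_on X Y E \<and> (\<forall>x\<in>R. degree E x = a x) \<and>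
    (\<forall>x\<in>X - insert r R. degree E x = 0) \<and> (\<forall>y\<in>Y. degree E y \<le> b y) \<and> degree E r \<le> a r" for E
  have "P E0"
    using E0 R(2) by (auto simp: P_def)
  moreover have "degree E r < Suc (a r)" if "P E" for E
    using that by (simp add: P_def less_Suc_eq_le)
  ultimately obtain E where "P E" and E_max: "\<And>E'. P E' \<Longrightarrow> degree E' r \<le> degree E r"
    using ex_has_greatest_nat[of P E0 "\<lambda>E. degree E r" "Suc (a r)"] by blast
  then have E: "bipartite_on X Y E" and dR: "\<And>x. x \<in> R \<Longrightarrow> degree E x = a x"
    and dX: "\<And>x. x \<in> X - insert r R \<Longrightarrow> degree E x = 0" and dY: "\<And>y. y \<in> Y \<Longrightarrow> degree E y \<le> b y"
    and dr: "degree E r \<le> a r"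
    by (auto simp: P_def)
  have graph: "graph_on (X \<union> Y) E"
    using E disj by (rule bipartite_on_graph_on)
  have finN: "finite (neighbors E' v)" if "bipartite_on X Y E'" for E' v
    using graph_on_finite(2)[OF bipartite_on_graph_on[OF that disj]] fin by blast
  have "degree E r = a r"
  proof (rule ccontr)
    assume "degree E r \<noteq> a r"
    then have less: "degree E r < a r" using dr by simp
    have ins: "bipartite_on X Y (insert {x, y} E')" if "bipartite_on X Y E'" "x \<in> X" "y \<in> Y" for x y E'
      using that by (auto simp: bipartite_on_def)
    \<comment> \<open>A missing edge from \<open>r\<close> to an unsaturated \<open>y\<close> could simply be added.\<close>
    have adj: "{r, y} \<in> E" if y: "y \<in> Y" "degree E y < b y" for y
    proof (rule ccontr)
      assume nE: "{r, y} \<notin> E"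
      have ry: "r \<noteq> y" "r \<in> X" "r \<notin> R" "r \<notin> Y" "y \<notin> X" using R disj y by auto
      have d: "degree (insert {r, y} E) v = degree E v + of_bool (v = r) + of_bool (v = y)" for v
        using degree_insert_edge[OF finN[OF E] ry(1) nE] .
      have "P (insert {r, y} E)"
        unfolding P_def
      proof (intro conjI ballI)
        show "bipartite_on X Y (insert {r, y} E)"
          using ins[OF E] y ry by blast
      qed (use ry R(1) y less dR dX dY in \<open>auto simp: d\<close>)
      then show False
        using E_max[of "insert {r, y} E"] d[of r] by simp
    qed
    have nb_Y: "neighbors E y \<subseteq> insert r R" if y: "y \<in> Y" for y
    proof
      fix x assume x: "x \<in> neighbors E y"
      then have "x \<in> X"
        using bipartite_on_neighbors(2)[OF E disj y] by blast
      moreover have "degree E x \<noteq> 0"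
        using x finN[OF E] unfolding degree_def neighbors_sym[of x E y] by (auto simp: card_eq_0_iff)
      ultimately show "x \<in> insert r R"
        using dX[of x] by (metis DiffI)
    qed
    have deg_Y: "degree E y = min (card (insert r R)) (b y)" if y: "y \<in> Y" for y
    proof (rule ccontr)
      assume neq: "degree E y \<noteq> min (card (insert r R)) (b y)"
      have fR: "finite (insert r R)"
        using R(1) fin(1) finite_subset by blast
      have "degree E y \<le> card (insert r R)"
        using nb_Y[OF y] fR by (simp add: degree_def card_mono del: card_insert_disjoint)
      then have lt: "degree E y < card (insert r R)" "degree E y < b y"
        using neq dY[OF y] by auto
      then have ry: "{r, y} \<in> E"
        using adj y by blast
      \<comment> \<open>If an unsaturated \<open>y\<close> misses some \<open>i\<close> in \<open>R\<close>, replacing \<open>{u, i}\<close> by \<open>{u, r}\<close> and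
        \<open>{i, y}\<close> raises only the degrees of \<open>r\<close> and \<open>y\<close>.\<close>
      obtain i where i: "i \<in> insert r R" "i \<notin> neighbors E y"
        using lt(1) fR unfolding degree_def
        by (meson card_mono finN[OF E] linorder_not_le subsetI)
      then have iR: "i \<in> R" "i \<noteq> r"
        using ry by (auto simp: neighbors_def insert_commute)
      obtain u where u: "{u, i} \<in> E" "{u, r} \<notin> E" "u \<noteq> r"
      proof (rule private_neighbor[OF finN[OF E]])
        show "degree E r < degree E i"
          using less bspec[OF R(3) iR(1)] dR[OF iR(1)] by simp
        show "i \<notin> neighbors E i"
          using graph_on_neighbors[OF graph] by auto
      qed (use iR in auto)
      have uY: "u \<in> Y"
        using bipartite_onD[OF E disj, of i u] u(1) iR R(1) by (auto simp: insert_commute)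
      have ne: "u \<noteq> i" "r \<noteq> y" "i \<noteq> y" "u \<noteq> y" "r \<notin> R" "r \<in> X" "i \<in> X" "i \<notin> Y" "r \<notin> Y" "y \<notin> X" "u \<notin> X"
        using uY iR R disj y u ry by (auto simp: insert_commute)
      define E1 where "E1 = E - {{u, i}}"
      define E2 where "E2 = insert {u, r} E1"
      define E3 where "E3 = insert {i, y} E2"
      have b1: "bipartite_on X Y E1"
        using E by (auto simp: bipartite_on_def E1_def)
      have b2: "bipartite_on X Y E2"
        unfolding E2_def insert_commute[of u] using ins[OF b1] ne(6) uY by blast
      have b3: "bipartite_on X Y E3"
        unfolding E3_def using ins[OF b2] ne(7) y by blast
      have d1: "degree E1 v + of_bool (v = u) + of_bool (v = i) = degree E v" for v
        unfolding E1_def by (rule degree_remove_edge) (use finN[OF E] u ne in auto)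
      have d2: "degree E2 v = degree E1 v + of_bool (v = u) + of_bool (v = r)" for v
        unfolding E2_def by (rule degree_insert_edge) (use finN[OF b1] u in \<open>auto simp: E1_def\<close>)
      have iy: "{i, y} \<notin> E2"
        using i(2) ne by (auto simp: E2_def E1_def neighbors_def doubleton_eq_iff insert_commute)
      have d3: "degree E3 v = degree E2 v + of_bool (v = i) + of_bool (v = y)" for v
        unfolding E3_def by (rule degree_insert_edge[OF finN[OF b2] ne(3)]) (rule iy)
      have d: "degree E3 v = degree E v + of_bool (v = r) + of_bool (v = y)" for v
        using d1[of v] d2[of v] d3[of v] by simp
      have "P E3"
        unfolding P_def
      proof (intro conjI ballI)
        show "bipartite_on X Y E3" by (rule b3)
      qed (use ne R(1) y lt less dR dX dY in \<open>auto simp: d\<close>)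
      then show False
        using E_max[of E3] d[of r] by simp
    qed
    have fR: "finite (insert r R)"
      using R(1) fin(1) finite_subset by blast
    have "(\<Sum>x\<in>insert r R. degree E x) = (\<Sum>x\<in>insert r R. card (neighbors E x \<inter> Y))"
    proof (rule sum.cong)
      fix x assume "x \<in> insert r R"
      then have "neighbors E x \<inter> Y = neighbors E x"
        using bipartite_on_neighbors(1)[OF E disj, of x] R by auto
      then show "degree E x = card (neighbors E x \<inter> Y)" by (simp add: degree_def)
    qed simp
    also have "\<dots> = (\<Sum>y\<in>Y. card (neighbors E y \<inter> insert r R))"
      using fR fin(2) by (rule edges_between_commute)
    also have "\<dots> = (\<Sum>y\<in>Y. degree E y)"
    proof (rule sum.cong)
      fix y assume y: "y \<in> Y"
      have "neighbors E y \<inter> insert r R = neighbors E y" using nb_Y[OF y] by blast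
      then show "card (neighbors E y \<inter> insert r R) = degree E y" by (simp add: degree_def)
    qed simp
    also have "\<dots> = (\<Sum>y\<in>Y. min (card (insert r R)) (b y))"
      using deg_Y by simp
    also have "\<dots> \<ge> (\<Sum>x\<in>insert r R. a x)"
      by (rule GR)
    finally have "(\<Sum>x\<in>insert r R. a x) \<le> (\<Sum>x\<in>insert r R. degree E x)" .
    moreover have "(\<Sum>x\<in>R. a x) = (\<Sum>x\<in>R. degree E x)"
      using dR by simp
    ultimately show False
      using less fR R(2) by simp
  qed
  then show ?thesis
    using \<open>P E\<close> by (intro exI[of _ E]) (auto simp: P_def)
qed

text \<open>Saturating all of \<open>X\<close> yields degrees at most \<open>b\<close> in \<open>Y\<close>; equality of the two sums turns them
into \<open>b\<close>.\<close>

theorem gale_ryser: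
  assumes fin: "finite X" "finite Y" and disj: "X \<inter> Y = {}"
  shows "bigraphic X Y a b \<longleftrightarrow> (\<Sum>x\<in>X. a x) = (\<Sum>y\<in>Y. b y) \<and>
    (\<forall>S\<subseteq>X. (\<Sum>x\<in>S. a x) \<le> (\<Sum>y\<in>Y. min (card S) (b y)))"
    (is "?L \<longleftrightarrow> ?R")
proof
  assume ?L
  then show ?R
    using gale_ryser_necessary[OF assms] by blast
next
  assume R: ?R
  define P where "P R \<longleftrightarrow> (\<exists>E. bipartite_on X Y E \<and> (\<forall>x\<in>R. degree E x = a x) \<and>
    (\<forall>x\<in>X - R. degree E x = 0) \<and> (\<forall>y\<in>Y. degree E y \<le> b y))" for R
  have "P X"
  proof (rule saturating_induct[where d = a])
    show "P {}"
      unfolding P_def by (rule exI[of _ "{}"]) (auto simp: bipartite_on_def degree_def neighbors_def)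
    show "P (insert r R)"
      if "R \<subseteq> X" "r \<in> X - R" "\<forall>v\<in>R. a r \<le> a v" "P R" for R r
    proof -
      have "(\<Sum>x\<in>insert r R. a x) \<le> (\<Sum>y\<in>Y. min (card (insert r R)) (b y))"
        using R that(1,2) by (metis DiffD1 insert_subset)
      then show ?thesis
        using that(4) gale_ryser_step[OF assms that(1-3)] unfolding P_def by blast
    qed
  qed (rule fin)
  then obtain E where E: "bipartite_on X Y E" and a: "\<And>x. x \<in> X \<Longrightarrow> degree E x = a x"
    and b: "\<And>y. y \<in> Y \<Longrightarrow> degree E y \<le> b y"
    by (auto simp: P_def)
  have "bigraphic X Y a (degree E)"
    using E a by (auto simp: bigraphic_def)
  then have "(\<Sum>y\<in>Y. degree E y) = (\<Sum>y\<in>Y. b y)"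
    using gale_ryser_necessary(1)[OF assms, of a "degree E"] R by simp
  then have "degree E y = b y" if "y \<in> Y" for y
    using sum_mono_inv[of "degree E" Y b y] b that fin(2) by blast
  then show ?L
    using E a by (auto simp: bigraphic_def)
qed

section \<open>The theorem of Erdos and Gallai\<close>

text \<open>A set \<open>S\<close> of at most \<open>k\<close> vertices has degree sum at most \<open>k * (k - 1)\<close> from edges inside \<open>S\<close>, and
every vertex outside sends at most \<open>min k (d v)\<close> edges into it.\<close>

lemma erdos_gallai_necessary:
  assumes fin: "finite V" and "graphic V d"
  shows "even (\<Sum>v\<in>V. d v)"
    and "S \<subseteq> V \<Longrightarrow> card S \<le> k \<Longrightarrow>
      (\<Sum>v\<in>S. d v) \<le> k * (k - 1) + (\<Sum>v\<in>V - S. min k (d v))"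
proof -
  obtain E where E: "graph_on V E" and d: "\<And>v. v \<in> V \<Longrightarrow> degree E v = d v"
    using assms(2) by (auto simp: graphic_def)
  have finN: "finite (neighbors E v)" for v
    using graph_on_finite(2)[OF E fin] .
  show "even (\<Sum>v\<in>V. d v)"
    using handshake[OF fin E] d by simp
  show "(\<Sum>v\<in>S. d v) \<le> k * (k - 1) + (\<Sum>v\<in>V - S. min k (d v))" if S: "S \<subseteq> V" "card S \<le> k"
  proof -
    have finS: "finite S"
      using S(1) fin by (rule finite_subset)
    have "(\<Sum>v\<in>S. d v) = (\<Sum>v\<in>S. card (neighbors E v \<inter> S) + card (neighbors E v \<inter> (V - S)))"
    proof (rule sum.cong)
      fix v assume "v \<in> S"
      then have "d v = card (neighbors E v \<inter> S) + card (neighbors E v - S)"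
        using card_neighbors_split[OF finN] d S(1) by (metis subsetD)
      moreover have "neighbors E v - S = neighbors E v \<inter> (V - S)"
        using graph_on_neighbors[OF E] by blast
      ultimately show "d v = card (neighbors E v \<inter> S) + card (neighbors E v \<inter> (V - S))"
        by simp
    qed simp
    also have "\<dots> = (\<Sum>v\<in>S. card (neighbors E v \<inter> S)) + (\<Sum>w\<in>V - S. card (neighbors E w \<inter> S))"
      using edges_between_commute[OF finS, of "V - S" E] fin by (simp add: sum.distrib)
    also have "\<dots> \<le> k * (k - 1) + (\<Sum>v\<in>V - S. min k (d v))"
    proof (rule add_mono)
      have "(\<Sum>v\<in>S. card (neighbors E v \<inter> S)) \<le> (\<Sum>v\<in>S. k - 1)"
      proof (rule sum_mono)
        fix v assume "v \<in> S"
        have "card (neighbors E v \<inter> S) \<le> card (S - {v})"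
          using finS graph_on_neighbors[OF E, of v] by (intro card_mono) auto
        also have "\<dots> \<le> k - 1"
          using S(2) \<open>v \<in> S\<close> finS by simp
        finally show "card (neighbors E v \<inter> S) \<le> k - 1" .
      qed
      also have "\<dots> \<le> k * (k - 1)"
        using S(2) by simp
      finally show "(\<Sum>v\<in>S. card (neighbors E v \<inter> S)) \<le> k * (k - 1)" .
      show "(\<Sum>w\<in>V - S. card (neighbors E w \<inter> S)) \<le> (\<Sum>v\<in>V - S. min k (d v))"
      proof (intro sum_mono min.boundedI)
        fix w assume "w \<in> V - S"
        show "card (neighbors E w \<inter> S) \<le> k"
          using S(2) card_mono[OF finS, of "neighbors E w \<inter> S"] by simp
        show "card (neighbors E w \<inter> S) \<le> d w"
          using d[of w] \<open>w \<in> V - S\<close> card_mono[OF finN, of "neighbors E w \<inter> S" w]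
          by (simp add: degree_def)
      qed
    qed
    finally show ?thesis .
  qed
qed

text \<open>The proof of Tripathi, Venugopalan and West. As in \<open>gale_ryser_step\<close>, vertices are saturated in the
order of decreasing \<open>d\<close>, and all edges meet the set of vertices treated so far. If in a graph
with the largest possible degree of \<open>r\<close> the vertex \<open>r\<close> is not saturated, then no exchange raises
that degree, and this forces \<open>insert r R\<close> to be a clique and every other vertex \<open>k\<close> to have degree
\<open>min (card (insert r R)) (d k)\<close>. Then the degree sum over \<open>insert r R\<close> equals the right-hand
side of the Erdos-Gallai inequality, although it is smaller than the sum of the \<open>d v\<close>.\<close>

lemma erdos_gallai_step:
  assumes fin: "finite V" and even: "even (\<Sum>v\<in>V. d v)"
    and R: "R \<subseteq> V" "r \<in> V - R" "\<forall>v\<in>R. d r \<le> d v"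
    and EG: "(\<Sum>v\<in>insert r R. d v) \<le> card (insert r R) * (card (insert r R) - 1) +
      (\<Sum>w\<in>V - insert r R. min (card (insert r R)) (d w))"
    and E0: "graph_on V E0" "\<forall>v\<in>R. degree E0 v = d v" "\<forall>e\<in>E0. e \<inter> R \<noteq> {}"
      "\<forall>v\<in>V. degree E0 v \<le> d v"
  shows "\<exists>E. graph_on V E \<and> (\<forall>v\<in>insert r R. degree E v = d v) \<and>
    (\<forall>e\<in>E. e \<inter> insert r R \<noteq> {}) \<and> (\<forall>v\<in>V. degree E v \<le> d v)"
proof -
  define P where "P E \<longleftrightarrow> graph_on V E \<and> (\<forall>v\<in>R. degree E v = d v) \<and>
    (\<forall>e\<in>E. e \<inter> insert r R \<noteq> {}) \<and> (\<forall>v\<in>V. degree E v \<le> d v)" for E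
  have "P E0"
    using E0 by (auto simp: P_def)
  moreover have "degree E r < Suc (d r)" if "P E" for E
    using that R(2) by (auto simp: P_def less_Suc_eq_le)
  ultimately obtain E where "P E" and E_max: "\<And>E'. P E' \<Longrightarrow> degree E' r \<le> degree E r"
    using ex_has_greatest_nat[of P E0 "\<lambda>E. degree E r" "Suc (d r)"] by blast
  then have E: "graph_on V E" and dR: "\<And>x. x \<in> R \<Longrightarrow> degree E x = d x"
    and indep: "\<And>e. e \<in> E \<Longrightarrow> e \<inter> insert r R \<noteq> {}" and dV: "\<And>v. v \<in> V \<Longrightarrow> degree E v \<le> d v"
    by (auto simp: P_def)
  have finN: "finite (neighbors E' v)" if "graph_on V E'" for E' v
    using graph_on_finite(2)[OF that fin] .
  have rV: "r \<in> V" "r \<notin> R" using R(2) by auto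
  have fR: "finite (insert r R)"
    using R(1) fin finite_subset by blast
  let ?R = "insert r R"
  have "degree E r = d r"
  proof (rule ccontr)
    assume "degree E r \<noteq> d r"
    then have less: "degree E r < d r" using dV[OF rV(1)] by simp
    have no_loop: "{v} \<notin> E" for v
      using E by (auto simp: graph_on_def)
    have priv: "\<exists>u. {u, i} \<in> E \<and> {u, r} \<notin> E \<and> u \<noteq> r \<and> u \<in> V \<and> u \<noteq> i" if "i \<in> R" for i
    proof (rule private_neighbor[OF finN[OF E]])
      show "degree E r < degree E i"
        using less bspec[OF R(3) that] dR[OF that] by simp
      show "i \<noteq> r" using that R(2) by auto
      show "i \<notin> neighbors E i"
        using graph_on_neighbors[OF E] by auto
    qed (use graph_on_edge[OF E] in blast)
    have ins: "degree (insert {x, y} E') v = degree E' v + of_bool (v = x) + of_bool (v = y)"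
      if "graph_on V E'" "x \<noteq> y" "{x, y} \<notin> E'" for E' x y v
      using degree_insert_edge[OF finN[OF that(1)] that(2,3)] .
    have del: "degree (E' - {{x, y}}) v + of_bool (v = x) + of_bool (v = y) = degree E' v"
      if "graph_on V E'" "{x, y} \<in> E'" for E' x y v
      using degree_remove_edge[OF finN[OF that(1)] _ that(2)] graph_on_edge(3)[OF that] by blast
    have adj_deficient: "{r, w} \<in> E" if w: "w \<in> V" "degree E w < d w" "w \<noteq> r" for w
    proof (rule ccontr)
      assume nE: "{r, w} \<notin> E"
      have g: "graph_on V (insert {r, w} E)"
        using graph_on_insert[OF E] rV w by blast
      have deg: "degree (insert {r, w} E) v = degree E v + of_bool (v = r) + of_bool (v = w)" for v
        using ins[OF E _ nE] w by blast
      have "P (insert {r, w} E)"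
        unfolding P_def
        by (intro conjI ballI g) (use rV R(1) w less dR dV indep in \<open>auto simp: deg\<close>)
      then show False
        using E_max[of "insert {r, w} E"] deg[of r] by simp
    qed
    \<comment> \<open>If \<open>r\<close> misses \<open>i\<close> in \<open>R\<close>, replacing \<open>{u, i}\<close> by \<open>{u, r}\<close> and \<open>{i, r}\<close> raises the degree of \<open>r\<close>
      by two and changes no other degree. If only one edge is missing at \<open>r\<close>, the even sum provides
      another unsaturated vertex \<open>k\<close>, and the edge \<open>{k, r}\<close> is removed in addition.\<close>
    have adj_R: "{r, i} \<in> E" if i: "i \<in> R" for i
    proof (rule ccontr)
      assume nE: "{r, i} \<notin> E"
      obtain u where u: "{u, i} \<in> E" "{u, r} \<notin> E" "u \<noteq> r" "u \<in> V" "u \<noteq> i"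
        using priv[OF i] by blast
      have i': "i \<in> V" "i \<noteq> r" using i R by auto
      define E1 where "E1 = E - {{u, i}}"
      define E2 where "E2 = insert {u, r} E1"
      define E3 where "E3 = insert {i, r} E2"
      have g: "graph_on V E1" "graph_on V E2" "graph_on V E3"
        unfolding E1_def E2_def E3_def using E u rV i' by (auto intro!: graph_on_Diff graph_on_insert)
      have d1: "degree E1 v + of_bool (v = u) + of_bool (v = i) = degree E v" for v
        unfolding E1_def by (rule del[OF E u(1)])
      have d2: "degree E2 v = degree E1 v + of_bool (v = u) + of_bool (v = r)" for v
        unfolding E2_def by (rule ins[OF g(1)]) (use u in \<open>auto simp: E1_def\<close>)
      have d3: "degree E3 v = degree E2 v + of_bool (v = i) + of_bool (v = r)" for v
        unfolding E3_def
        by (rule ins[OF g(2)])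
          (use u i' nE in \<open>auto simp: E1_def E2_def doubleton_eq_iff insert_commute\<close>)
      have deg3: "degree E3 v = degree E v + 2 * of_bool (v = r)" for v
        using d1[of v] d2[of v] d3[of v] by simp
      have indep3: "e \<inter> ?R \<noteq> {}" if "e \<in> E3" for e
        using that indep by (auto simp: E1_def E2_def E3_def)
      show False
      proof (cases "degree E r + 2 \<le> d r")
        case True
        have "P E3"
          unfolding P_def
          by (intro conjI ballI g indep3) (use rV dR dV True in \<open>auto simp: deg3\<close>)
        then show False
          using E_max[of E3] deg3[of r] by simp
      next
        case False
        have "\<exists>k\<in>V. k \<noteq> r \<and> degree E k < d k"
        proof (rule ccontr)
          assume "\<not> ?thesis"
          then have "\<forall>k\<in>V - {r}. degree E k = d k"
            using dV le_neq_implies_less by blast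
          then have "(\<Sum>v\<in>V. d v) = d r + (\<Sum>v\<in>V - {r}. degree E v)"
            using rV fin by (simp add: sum.remove)
          also have "\<dots> = (\<Sum>v\<in>V. degree E v) + 1"
            using False less rV fin by (simp add: sum.remove[of V r])
          finally show False
            using even handshake[OF fin E] by simp
        qed
        then obtain k where k: "k \<in> V" "k \<noteq> r" "degree E k < d k" by blast
        have kE: "{k, r} \<in> E"
          using adj_deficient[OF k(1,3,2)] by (simp add: insert_commute)
        have "k \<notin> R"
          using k(3) dR by auto
        have kne: "k \<noteq> u" "k \<noteq> i" "{k, r} \<in> E3"
          using kE u nE by (auto simp: E1_def E2_def E3_def insert_commute doubleton_eq_iff)
        define E4 where "E4 = E3 - {{k, r}}"
        have g4: "graph_on V E4"
          unfolding E4_def by (rule graph_on_Diff[OF g(3)])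
        have deg4: "degree E4 v + of_bool (v = k) + of_bool (v = r) = degree E v + 2 * of_bool (v = r)" for v
          unfolding E4_def using del[OF g(3) kne(3), of v] deg3[of v] by simp
        have deg4': "degree E4 v = (if v = r then Suc (degree E r) else if v = k then degree E k - 1
            else degree E v)" for v
          using deg4[of v] k(2) by (auto split: if_splits)
        have "P E4"
          unfolding P_def
        proof (intro conjI ballI g4)
          show "e \<inter> ?R \<noteq> {}" if "e \<in> E4" for e
            using that indep3 by (auto simp: E4_def)
          show "degree E4 v \<le> d v" if "v \<in> V" for v
            using dV[OF that] less k(3) by (auto simp: deg4')
        qed (use rV dR less k \<open>k \<notin> R\<close> in \<open>auto simp: deg4'\<close>)
        then show False
          using E_max[of E4] by (simp add: deg4')
      qed
    qed
    have nb_S: "neighbors E w \<subseteq> ?R" if "w \<in> V - ?R" for w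
      using indep that by (fastforce simp: neighbors_def)
    \<comment> \<open>If an unsaturated \<open>k\<close> outside misses some \<open>i\<close> in \<open>R\<close>, replacing \<open>{u, i}\<close> by \<open>{u, r}\<close> and
      \<open>{i, k}\<close> raises only the degrees of \<open>r\<close> and \<open>k\<close>.\<close>
    have deg_S: "degree E k = min (card ?R) (d k)" if k: "k \<in> V - ?R" for k
    proof (rule ccontr)
      assume neq: "degree E k \<noteq> min (card ?R) (d k)"
      have "degree E k \<le> card ?R"
        using nb_S[OF k] fR by (simp add: degree_def card_mono del: card_insert_disjoint)
      then have lt: "degree E k < card ?R" "degree E k < d k"
        using neq dV[of k] k by auto
      then have kr: "{r, k} \<in> E"
        using adj_deficient k by blast
      obtain i where i: "i \<in> ?R" "i \<notin> neighbors E k"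
        using lt(1) fR unfolding degree_def
        by (meson card_mono finN[OF E] linorder_not_le subsetI)
      then have iR: "i \<in> R" "i \<noteq> r" "i \<in> V" "i \<noteq> k" "{i, k} \<notin> E"
        using kr k R(1) rV by (auto simp: neighbors_def insert_commute)
      obtain u where u: "{u, i} \<in> E" "{u, r} \<notin> E" "u \<noteq> r" "u \<in> V" "u \<noteq> i"
        using priv[OF iR(1)] by blast
      have uk: "u \<noteq> k"
        using u kr by (auto simp: insert_commute)
      define E1 where "E1 = E - {{u, i}}"
      define E2 where "E2 = insert {u, r} E1"
      define E3 where "E3 = insert {i, k} E2"
      have g: "graph_on V E1" "graph_on V E2" "graph_on V E3"
        unfolding E1_def E2_def E3_def using E u rV iR k
        by (auto intro!: graph_on_Diff graph_on_insert)
      have d1: "degree E1 v + of_bool (v = u) + of_bool (v = i) = degree E v" for v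
        unfolding E1_def by (rule del[OF E u(1)])
      have d2: "degree E2 v = degree E1 v + of_bool (v = u) + of_bool (v = r)" for v
        unfolding E2_def by (rule ins[OF g(1)]) (use u in \<open>auto simp: E1_def\<close>)
      have d3: "degree E3 v = degree E2 v + of_bool (v = i) + of_bool (v = k)" for v
        unfolding E3_def
        by (rule ins[OF g(2)]) (use u iR uk in \<open>auto simp: E1_def E2_def doubleton_eq_iff\<close>)
      have deg3: "degree E3 v = degree E v + of_bool (v = r) + of_bool (v = k)" for v
        using d1[of v] d2[of v] d3[of v] by simp
      have "P E3"
        unfolding P_def
      proof (intro conjI ballI g)
        show "e \<inter> ?R \<noteq> {}" if "e \<in> E3" for e
          using that indep iR by (auto simp: E1_def E2_def E3_def)
      qed (use rV dR dV less lt k in \<open>auto simp: deg3\<close>)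
      then show False
        using E_max[of E3] deg3[of r] by simp
    qed
    \<comment> \<open>For non-adjacent \<open>i\<close>, \<open>j\<close> in \<open>R\<close>, replace \<open>{u, i}\<close> and \<open>{w, j}\<close> by \<open>{i, j}\<close> and \<open>{u, r}\<close>. Here \<open>u\<close>
      and \<open>w\<close> may coincide, and \<open>w\<close>, being outside \<open>R\<close>, may lose an edge.\<close>
    have clique: "{i, j} \<in> E" if ij: "i \<in> ?R" "j \<in> ?R" "i \<noteq> j" for i j
    proof (rule ccontr)
      assume nE: "{i, j} \<notin> E"
      then have R': "i \<in> R" "j \<in> R" "i \<noteq> r" "j \<noteq> r" "i \<in> V" "j \<in> V"
        using ij adj_R R rV by (auto simp: insert_commute)
      obtain u where u: "{u, i} \<in> E" "{u, r} \<notin> E" "u \<noteq> r" "u \<in> V" "u \<noteq> i"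
        using priv[OF R'(1)] by blast
      obtain w where w: "{w, j} \<in> E" "{w, r} \<notin> E" "w \<noteq> r" "w \<in> V" "w \<noteq> j"
        using priv[OF R'(2)] by blast
      have uwR: "u \<notin> R" "w \<notin> R"
        using adj_R[of u] adj_R[of w] u(2) w(2) by (auto simp: insert_commute)
      define E1 where "E1 = E - {{u, i}}"
      define E2 where "E2 = E1 - {{w, j}}"
      define E3 where "E3 = insert {u, r} E2"
      define E4 where "E4 = insert {i, j} E3"
      have ne: "{w, j} \<noteq> {u, i}"
        using ij uwR R' by (auto simp: doubleton_eq_iff)
      have g: "graph_on V E1" "graph_on V E2" "graph_on V E3" "graph_on V E4"
        unfolding E1_def E2_def E3_def E4_def using E u rV R' ij
        by (auto intro!: graph_on_Diff graph_on_insert)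
      have d1: "degree E1 v + of_bool (v = u) + of_bool (v = i) = degree E v" for v
        unfolding E1_def by (rule del[OF E u(1)])
      have d2: "degree E2 v + of_bool (v = w) + of_bool (v = j) = degree E1 v" for v
        unfolding E2_def by (rule del[OF g(1)]) (use w ne in \<open>auto simp: E1_def\<close>)
      have d3: "degree E3 v = degree E2 v + of_bool (v = u) + of_bool (v = r)" for v
        unfolding E3_def by (rule ins[OF g(2)]) (use u in \<open>auto simp: E1_def E2_def\<close>)
      have d4: "degree E4 v = degree E3 v + of_bool (v = i) + of_bool (v = j)" for v
        unfolding E4_def
        by (rule ins[OF g(3)])
          (use ij nE R' in \<open>auto simp: E1_def E2_def E3_def doubleton_eq_iff\<close>)
      have deg: "degree E4 v + of_bool (v = w) = degree E v + of_bool (v = r)" for v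
        using d1[of v] d2[of v] d3[of v] d4[of v] by simp
      have deg': "degree E4 v = (if v = r then Suc (degree E r) else if v = w then degree E w - 1
          else degree E v)" for v
        using deg[of v] w(3) by (auto split: if_splits)
      have "P E4"
        unfolding P_def
      proof (intro conjI ballI g)
        show "e \<inter> ?R \<noteq> {}" if "e \<in> E4" for e
          using that indep R' by (auto simp: E1_def E2_def E3_def E4_def)
        show "degree E4 v \<le> d v" if "v \<in> V" for v
          using dV[OF that] less by (auto simp: deg')
      qed (use rV dR less uwR in \<open>auto simp: deg'\<close>)
      then show False
        using E_max[of E4] by (simp add: deg')
    qed
    have "(\<Sum>v\<in>?R. degree E v) = (\<Sum>v\<in>?R. (card ?R - 1) + card (neighbors E v \<inter> (V - ?R)))"
    proof (rule sum.cong)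
      fix v assume v: "v \<in> ?R"
      have "neighbors E v \<inter> ?R = ?R - {v}"
        using clique[OF v] graph_on_neighbors[OF E, of v] by (auto simp: neighbors_def)
      moreover have "neighbors E v - ?R = neighbors E v \<inter> (V - ?R)"
        using graph_on_neighbors[OF E] by blast
      ultimately show "degree E v = (card ?R - 1) + card (neighbors E v \<inter> (V - ?R))"
        using card_neighbors_split[OF finN[OF E], of v ?R] v fR by (simp only: card_Diff_singleton)
    qed simp
    also have "\<dots> = card ?R * (card ?R - 1) + (\<Sum>v\<in>?R. card (neighbors E v \<inter> (V - ?R)))"
      by (simp only: sum.distrib sum_constant of_nat_id)
    also have "(\<Sum>v\<in>?R. card (neighbors E v \<inter> (V - ?R))) = (\<Sum>w\<in>V - ?R. card (neighbors E w \<inter> ?R))"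
      using fR fin by (intro edges_between_commute) auto
    also have "\<dots> = (\<Sum>w\<in>V - ?R. min (card ?R) (d w))"
    proof (rule sum.cong)
      fix w assume w: "w \<in> V - ?R"
      then have "neighbors E w \<inter> ?R = neighbors E w"
        using nb_S by blast
      then show "card (neighbors E w \<inter> ?R) = min (card ?R) (d w)"
        using deg_S[OF w] by (simp add: degree_def)
    qed simp
    finally have "(\<Sum>v\<in>?R. d v) \<le> (\<Sum>v\<in>?R. degree E v)"
      using EG by simp
    moreover have "(\<Sum>x\<in>R. d x) = (\<Sum>x\<in>R. degree E x)"
      using dR by simp
    ultimately show False
      using less fR rV by simp
  qed
  then show ?thesis
    using \<open>P E\<close> by (intro exI[of _ E]) (auto simp: P_def)
qed

theorem erdos_gallai:
  assumes fin: "finite V"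
  shows "graphic V d \<longleftrightarrow> even (\<Sum>v\<in>V. d v) \<and>
    (\<forall>S\<subseteq>V. (\<Sum>v\<in>S. d v) \<le> card S * (card S - 1) + (\<Sum>v\<in>V - S. min (card S) (d v)))"
    (is "?L \<longleftrightarrow> ?R")
proof
  assume ?L
  then show ?R
    using erdos_gallai_necessary[OF fin] by blast
next
  assume R: ?R
  define P where "P R \<longleftrightarrow> (\<exists>E. graph_on V E \<and> (\<forall>v\<in>R. degree E v = d v) \<and>
    (\<forall>e\<in>E. e \<inter> R \<noteq> {}) \<and> (\<forall>v\<in>V. degree E v \<le> d v))" for R
  have "P V"
  proof (rule saturating_induct[where d = d])
    show "P {}"
      unfolding P_def by (rule exI[of _ "{}"]) (auto simp: graph_on_def degree_def neighbors_def)
    show "P (insert r R)"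
      if RV: "R \<subseteq> V" "r \<in> V - R" "\<forall>v\<in>R. d r \<le> d v" and PR: "P R" for R r
    proof -
      have sub: "insert r R \<subseteq> V" using that by blast
      obtain E0 where "graph_on V E0" "\<forall>v\<in>R. degree E0 v = d v" "\<forall>e\<in>E0. e \<inter> R \<noteq> {}"
        "\<forall>v\<in>V. degree E0 v \<le> d v"
        using PR unfolding P_def by blast
      then show ?thesis
        using erdos_gallai_step[OF fin conjunct1[OF R] that(1-3) _] R sub unfolding P_def by presburger
    qed
  qed (rule fin)
  then show ?L
    by (auto simp: P_def graphic_def)
qed

section \<open>Largest sums over vertex sets of bounded size\<close>

text \<open>The elements of \<open>S - T\<close> are at most as many as those of \<open>T - S\<close>, and each of them weighs at most as
much as the lightest element of \<open>T - S\<close>.\<close>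

lemma top_subset_bound:
  fixes lev :: "'a \<Rightarrow> nat" and w :: "nat \<Rightarrow> nat"
  assumes fin: "finite V" and T: "T \<subseteq> V" "\<And>v u. v \<in> T \<Longrightarrow> u \<in> V - T \<Longrightarrow> lev u \<le> lev v"
    and S: "S \<subseteq> V" "card S \<le> card T" and w: "mono w"
  shows "(\<Sum>v\<in>S. w (lev v)) \<le> (\<Sum>v\<in>T. w (lev v))"
proof -
  have finS: "finite S" and finT: "finite T"
    using fin S(1) T(1) finite_subset by blast+
  have card: "card (S - T) \<le> card (T - S)"
    using S(2) card_Diff_subset_Int[of S T] card_Diff_subset_Int[of T S] finS finT
    by (simp add: Int_commute)
  have "(\<Sum>v\<in>S - T. w (lev v)) \<le> (\<Sum>v\<in>T - S. w (lev v))"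
  proof (cases "T - S = {}")
    case True
    then have "card (S - T) = 0"
      using card by (simp only: card.empty)
    then have "S - T = {}"
      using finS by (simp only: card_0_eq finite_Diff)
    then show ?thesis by (simp only: sum.empty)
  next
    case False
    define m where "m = Min ((\<lambda>v. w (lev v)) ` (T - S))"
    have "m \<in> (\<lambda>v. w (lev v)) ` (T - S)"
      unfolding m_def using False finT by (intro Min_in) auto
    then obtain v0 where v0: "v0 \<in> T - S" "m = w (lev v0)" by blast
    have "(\<Sum>v\<in>S - T. w (lev v)) \<le> (\<Sum>v\<in>S - T. m)"
    proof (rule sum_mono)
      fix v assume "v \<in> S - T"
      then have "lev v \<le> lev v0"
        using T(2)[of v0 v] v0 S(1) by blast
      then show "w (lev v) \<le> m"
        using w v0(2) by (simp add: monoD)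
    qed
    also have "\<dots> \<le> (\<Sum>v\<in>T - S. m)"
      using card by simp
    also have "\<dots> \<le> (\<Sum>v\<in>T - S. w (lev v))"
      unfolding m_def using finT by (intro sum_mono Min_le) auto
    finally show ?thesis .
  qed
  then have "(\<Sum>v\<in>S \<inter> T. w (lev v)) + (\<Sum>v\<in>S - T. w (lev v))
      \<le> (\<Sum>v\<in>T \<inter> S. w (lev v)) + (\<Sum>v\<in>T - S. w (lev v))"
    by (simp add: Int_commute)
  then show ?thesis
    by (simp only: sum.Int_Diff[OF finS, symmetric] sum.Int_Diff[OF finT, symmetric])
qed

text \<open>The recursion of the program: \<open>s r\<close> is the number of available elements of level \<open>r\<close>, an element of
level \<open>r\<close> has weight \<open>w r\<close>, and \<open>greedy w s l k\<close> is the largest weight of at most \<open>k\<close> elements of levels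
\<open>1, \<dots>, l\<close>. With \<open>w r = r\<close> it yields \<open>t\<close>, with \<open>w r = min r k\<close> the second family.\<close>

fun greedy :: "(nat \<Rightarrow> nat) \<Rightarrow> (nat \<Rightarrow> nat) \<Rightarrow> nat \<Rightarrow> nat \<Rightarrow> nat" where
  "greedy w s 0 k = 0"
| "greedy w s (Suc l) k =
     Max ((\<lambda>k'. greedy w s l (k - k') + w (Suc l) * min k' (s (Suc l))) ` {0..k})"

text \<open>Together with \<open>greedy_attained\<close>: the recursion computes a maximum. The choice of \<open>k'\<close> in its last step
is the number of selected elements of the highest level.\<close>

lemma greedy_upper:
  assumes "finite V" and "\<And>r. r \<in> {1..l} \<Longrightarrow> s r = card {v \<in> V. lev v = r}"
    and "S \<subseteq> V" "card S \<le> k" "\<forall>v\<in>S. lev v \<in> {1..l}"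
  shows "(\<Sum>v\<in>S. w (lev v)) \<le> greedy w s l k"
  using assms(2-)
proof (induction l arbitrary: S k)
  case 0
  then have "S = {}" by auto
  then show ?case by simp
next
  case (Suc l)
  have finS: "finite S"
    using Suc.prems(2) assms(1) finite_subset by blast
  define S1 where "S1 = {v \<in> S. lev v = Suc l}"
  have S1: "S1 \<subseteq> S" "finite S1"
    using finS by (auto simp: S1_def)
  have k': "card S1 \<le> s (Suc l)" "card S1 \<le> k"
  proof -
    have "S1 \<subseteq> {v \<in> V. lev v = Suc l}"
      using Suc.prems(2) by (auto simp: S1_def)
    then show "card S1 \<le> s (Suc l)"
      using Suc.prems(1)[of "Suc l"] assms(1) by (simp add: card_mono)
    show "card S1 \<le> k"
      using card_mono[OF finS S1(1)] Suc.prems(3) by simp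
  qed
  have "(\<Sum>v\<in>S - S1. w (lev v)) \<le> greedy w s l (k - card S1)"
  proof (rule Suc.IH)
    show "card (S - S1) \<le> k - card S1"
      using Suc.prems(3) S1 by (simp add: card_Diff_subset)
    show "\<forall>v\<in>S - S1. lev v \<in> {1..l}"
      using Suc.prems(4) by (auto simp: S1_def le_Suc_eq)
  qed (use Suc.prems in auto)
  moreover have "(\<Sum>v\<in>S1. w (lev v)) = w (Suc l) * min (card S1) (s (Suc l))"
    using k'(1) by (simp add: S1_def min_absorb1)
  moreover have "(\<Sum>v\<in>S. w (lev v)) = (\<Sum>v\<in>S - S1. w (lev v)) + (\<Sum>v\<in>S1. w (lev v))"
    using S1 finS by (simp add: sum.subset_diff)
  ultimately have "(\<Sum>v\<in>S. w (lev v)) \<le>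
      greedy w s l (k - card S1) + w (Suc l) * min (card S1) (s (Suc l))"
    by simp
  also have "\<dots> \<le> greedy w s (Suc l) k"
    unfolding greedy.simps using k'(2) by (intro Max_ge) auto
  finally show ?case .
qed

lemma greedy_attained:
  assumes "finite V" and "\<And>r. r \<in> {1..l} \<Longrightarrow> s r = card {v \<in> V. lev v = r}"
  shows "\<exists>S\<subseteq>V. card S \<le> k \<and> (\<forall>v\<in>S. lev v \<in> {1..l}) \<and> (\<Sum>v\<in>S. w (lev v)) = greedy w s l k"
  using assms(2)
proof (induction l arbitrary: k)
  case 0
  show ?case by (intro exI[of _ "{}"]) simp
next
  case (Suc l)
  have "greedy w s (Suc l) k \<in>
      (\<lambda>k'. greedy w s l (k - k') + w (Suc l) * min k' (s (Suc l))) ` {0..k}"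
    unfolding greedy.simps by (intro Max_in) auto
  then obtain k' where k': "k' \<le> k"
    "greedy w s (Suc l) k = greedy w s l (k - k') + w (Suc l) * min k' (s (Suc l))"
    unfolding image_iff by (metis atLeastAtMost_iff)
  obtain S0 where S0: "S0 \<subseteq> V" "card S0 \<le> k - k'" "\<forall>v\<in>S0. lev v \<in> {1..l}"
    "(\<Sum>v\<in>S0. w (lev v)) = greedy w s l (k - k')"
    using Suc.IH[of "k - k'"] Suc.prems by auto
  have "min k' (s (Suc l)) \<le> card {v \<in> V. lev v = Suc l}"
    using Suc.prems[of "Suc l"] by simp
  then obtain S1 where S1: "S1 \<subseteq> {v \<in> V. lev v = Suc l}" "card S1 = min k' (s (Suc l))" "finite S1"
    by (rule obtain_subset_with_card_n)
  have fin0: "finite S0" using S0(1) assms(1) finite_subset by blast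
  have disj: "S0 \<inter> S1 = {}" using S0(3) S1(1) by fastforce
  have sum1: "(\<Sum>v\<in>S1. w (lev v)) = card S1 * w (Suc l)"
  proof -
    have "(\<Sum>v\<in>S1. w (lev v)) = (\<Sum>v\<in>S1. w (Suc l))"
      using S1(1) by (intro sum.cong) auto
    then show ?thesis by simp
  qed
  show ?case
  proof (intro exI conjI)
    show "S0 \<union> S1 \<subseteq> V" using S0(1) S1(1) by blast
    show "card (S0 \<union> S1) \<le> k"
      using card_Un_le[of S0 S1] S0(2) S1(2) k'(1) by linarith
    show "\<forall>v\<in>S0 \<union> S1. lev v \<in> {1..Suc l}"
      using S0(3) S1(1) by fastforce
    show "(\<Sum>v\<in>S0 \<union> S1. w (lev v)) = greedy w s (Suc l) k"
      using sum.union_disjoint[OF fin0 S1(3) disj, of "\<lambda>v. w (lev v)"] S0(4) S1(2) k'(2) sum1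
      by simp
  qed
qed

text \<open>Elements of level \<open>0\<close>, which the recursion ignores, may be included when they weigh nothing.\<close>

lemma greedy_ge_sum:
  assumes fin: "finite V" and s: "\<And>r. r \<in> {1..l} \<Longrightarrow> s r = card {v \<in> V. lev v = r}"
    and lev: "\<And>v. v \<in> V \<Longrightarrow> lev v \<le> l" and "w 0 = 0" and S: "S \<subseteq> V" "card S \<le> k"
  shows "(\<Sum>v\<in>S. w (lev v)) \<le> greedy w s l k"
proof -
  let ?S = "{v \<in> S. lev v \<noteq> 0}"
  have finS: "finite S"
    using S(1) fin finite_subset by blast
  have "(\<Sum>v\<in>S. w (lev v)) = (\<Sum>v\<in>?S. w (lev v))"
    using finS \<open>w 0 = 0\<close> by (intro sum.mono_neutral_right) auto
  also have "\<dots> \<le> greedy w s l k"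
  proof (rule greedy_upper[OF fin s])
    show "card ?S \<le> k"
      using S(2) card_mono[OF finS, of ?S] by fastforce
    show "\<forall>v\<in>?S. lev v \<in> {1..l}"
      using lev S(1) by fastforce
  qed (use S(1) in auto)
  finally show ?thesis .
qed

text \<open>The set \<open>T\<close> is chosen before the weight \<open>w\<close>: elements of highest level are optimal for all
monotone weights at once. This permits comparing the two greedy values of an Erdos-Gallai
inequality with a single vertex set.\<close>

lemma greedy_common_optimum:
  assumes fin: "finite V" and s: "\<And>r. r \<in> {1..l} \<Longrightarrow> s r = card {v \<in> V. lev v = r}"
  shows "\<exists>T\<subseteq>V. card T \<le> k \<and> (\<forall>w. mono w \<longrightarrow> greedy w s l k \<le> (\<Sum>v\<in>T. w (lev v)))"
proof -
  obtain T where T: "T \<subseteq> V" "card T = min k (card V)" "\<forall>v\<in>T. \<forall>u\<in>V - T. lev u \<le> lev v"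
    using top_subset_induct[where P = "\<lambda>_. True" and m = "min k (card V)" and d = lev, OF fin] by auto
  have "greedy w s l k \<le> (\<Sum>v\<in>T. w (lev v))" if "mono w" for w
  proof -
    obtain S where S: "S \<subseteq> V" "card S \<le> k" "(\<Sum>v\<in>S. w (lev v)) = greedy w s l k"
      using greedy_attained[OF fin s, of l k w] by blast
    have "card S \<le> card T"
      using S(1,2) T(2) card_mono[OF fin S(1)] by simp
    then show ?thesis
      using top_subset_bound[OF fin T(1) _ S(1) _ that, of lev] T(3) S(3) by simp
  qed
  then show ?thesis
    using T by (intro exI[of _ T]) simp
qed

lemma greedy_le:
  assumes "\<And>r. w r \<le> r"
  shows "greedy w s l k \<le> l * k"
proof (induction l arbitrary: k)
  case (Suc l)
  have "greedy w s l (k - k') + w (Suc l) * min k' (s (Suc l)) \<le> Suc l * k" if "k' \<le> k" for k'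
  proof -
    have "greedy w s l (k - k') + w (Suc l) * min k' (s (Suc l)) \<le> l * (k - k') + Suc l * k'"
      using Suc[of "k - k'"] assms[of "Suc l"] by (intro add_mono mult_mono) auto
    also have "\<dots> \<le> Suc l * (k - k') + Suc l * k'" by simp
    also have "\<dots> = Suc l * k"
      using that by (simp flip: distrib_left)
    finally show ?thesis .
  qed
  then show ?case by (subst greedy.simps, subst Max_le_iff) auto
qed simp

section \<open>Degree sequences given by their multiplicities\<close>

text \<open>The inequality is the Erdos-Gallai inequality with \<open>\<Sum>v\<in>S. min k (d v)\<close> added on both sides, so that
the sum on the right extends over all of \<open>V\<close> and both terms on the left are maximal sums over sets
of at most \<open>k\<close> vertices. For \<open>card S > \<Delta>\<close> the inequality holds because every degree is at most \<open>card S - 1\<close>.\<close>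

lemma graphic_iff_greedy:
  assumes fin: "finite V" and d: "\<And>v. v \<in> V \<Longrightarrow> d v \<le> l" and "l \<le> \<Delta>"
    and s: "\<And>r. r \<in> {1..l} \<Longrightarrow> s r = card {v \<in> V. d v = r}"
  shows "graphic V d \<longleftrightarrow> even (\<Sum>v\<in>V. d v) \<and>
    (\<forall>k\<in>{1..\<Delta>}. greedy (\<lambda>r. r) s l k + greedy (\<lambda>r. min r k) s l k
      \<le> k * (k - 1) + (\<Sum>v\<in>V. min k (d v)))"
    (is "?L \<longleftrightarrow> ?R")
proof
  assume L: ?L
  have "greedy (\<lambda>r. r) s l k + greedy (\<lambda>r. min r k) s l k \<le> k * (k - 1) + (\<Sum>v\<in>V. min k (d v))" for k
  proof -
    obtain T where T: "T \<subseteq> V" "card T \<le> k"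
      and opt: "\<And>w. mono w \<Longrightarrow> greedy w s l k \<le> (\<Sum>v\<in>T. w (d v))"
      using greedy_common_optimum[where lev = d, OF fin s] by blast
    have "greedy (\<lambda>r. r) s l k \<le> (\<Sum>v\<in>T. d v)"
      by (rule opt) (auto intro: monoI)
    also have "\<dots> \<le> k * (k - 1) + (\<Sum>v\<in>V - T. min k (d v))"
      by (rule erdos_gallai_necessary(2)[OF fin L T])
    finally have "greedy (\<lambda>r. r) s l k \<le> k * (k - 1) + (\<Sum>v\<in>V - T. min k (d v))" .
    moreover have "greedy (\<lambda>r. min r k) s l k \<le> (\<Sum>v\<in>T. min k (d v))"
      using opt[of "\<lambda>r. min r k"] by (simp add: monoI min.commute)
    ultimately show ?thesis
      using sum.subset_diff[OF T(1) fin, of "\<lambda>v. min k (d v)"] by linarith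
  qed
  then show ?R
    using erdos_gallai_necessary(1)[OF fin L] by blast
next
  assume R: ?R
  have "(\<Sum>v\<in>S. d v) \<le> card S * (card S - 1) + (\<Sum>v\<in>V - S. min (card S) (d v))" if S: "S \<subseteq> V" for S
  proof -
    let ?k = "card S"
    consider "?k = 0" | "?k \<in> {1..\<Delta>}" | "?k > \<Delta>" by fastforce
    then show ?thesis
    proof cases
      case 1
      then show ?thesis
        using S fin by (simp add: finite_subset)
    next
      case 2
      have "(\<Sum>v\<in>S. d v) \<le> greedy (\<lambda>r. r) s l ?k"
        using greedy_ge_sum[where w = "\<lambda>r. r" and lev = d, OF fin s d _ S order_refl] by simp
      moreover have "(\<Sum>v\<in>S. min ?k (d v)) \<le> greedy (\<lambda>r. min r ?k) s l ?k"
        using greedy_ge_sum[where w = "\<lambda>r. min r ?k" and lev = d, OF fin s d _ S order_refl]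
        by (simp add: min.commute)
      moreover have "greedy (\<lambda>r. r) s l ?k + greedy (\<lambda>r. min r ?k) s l ?k
          \<le> ?k * (?k - 1) + (\<Sum>v\<in>V. min ?k (d v))"
        using R 2 by blast
      ultimately show ?thesis
        using sum.subset_diff[OF S fin, of "\<lambda>v. min ?k (d v)"] by linarith
    next
      case 3
      have "(\<Sum>v\<in>S. d v) \<le> (\<Sum>v\<in>S. ?k - 1)"
      proof (rule sum_mono)
        fix v assume "v \<in> S"
        then have "d v \<le> l"
          using d S by blast
        then show "d v \<le> ?k - 1"
          using \<open>l \<le> \<Delta>\<close> 3 by linarith
      qed
      then show ?thesis by simp
    qed
  qed
  then show ?L
    using R erdos_gallai[OF fin] by blast
qed

text \<open>The inequalities with \<open>k \<ge> \<Delta>\<close> follow from the equality of the sums, since then \<open>min k (b y) = b y\<close>.\<close>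

lemma bigraphic_iff_greedy:
  assumes fin: "finite X" "finite Y" and disj: "X \<inter> Y = {}"
    and a: "\<And>x. x \<in> X \<Longrightarrow> a x \<le> l" and b: "\<And>y. y \<in> Y \<Longrightarrow> b y \<le> \<Delta>"
    and s: "\<And>r. r \<in> {1..l} \<Longrightarrow> s r = card {x \<in> X. a x = r}"
  shows "bigraphic X Y a b \<longleftrightarrow> (\<Sum>x\<in>X. a x) = (\<Sum>y\<in>Y. b y) \<and>
    (\<forall>k\<in>{1..\<Delta> - 1}. greedy (\<lambda>r. r) s l k \<le> (\<Sum>y\<in>Y. min k (b y)))"
    (is "?L \<longleftrightarrow> ?R")
proof
  assume L: ?L
  have "greedy (\<lambda>r. r) s l k \<le> (\<Sum>y\<in>Y. min k (b y))" for k
  proof -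
    obtain T where T: "T \<subseteq> X" "card T \<le> k"
      and opt: "\<And>w. mono w \<Longrightarrow> greedy w s l k \<le> (\<Sum>x\<in>T. w (a x))"
      using greedy_common_optimum[where lev = a, OF fin(1) s] by blast
    have "greedy (\<lambda>r. r) s l k \<le> (\<Sum>x\<in>T. a x)"
      by (rule opt) (auto intro: monoI)
    also have "\<dots> \<le> (\<Sum>y\<in>Y. min k (b y))"
      by (rule gale_ryser_necessary(2)[OF fin disj L T])
    finally show ?thesis .
  qed
  then show ?R
    using gale_ryser_necessary(1)[OF fin disj L] by blast
next
  assume R: ?R
  have "(\<Sum>x\<in>S. a x) \<le> (\<Sum>y\<in>Y. min (card S) (b y))" if S: "S \<subseteq> X" for S
  proof -
    let ?k = "card S"
    consider "?k = 0" | "?k \<in> {1..\<Delta> - 1}" | "?k \<ge> \<Delta>" by fastforce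
    then show ?thesis
    proof cases
      case 1
      then show ?thesis
        using S fin by (simp add: finite_subset)
    next
      case 2
      have "(\<Sum>x\<in>S. a x) \<le> greedy (\<lambda>r. r) s l ?k"
        using greedy_ge_sum[where w = "\<lambda>r. r" and lev = a, OF fin(1) s a _ S order_refl] by simp
      then show ?thesis
        using R 2 by fastforce
    next
      case 3
      have "(\<Sum>x\<in>S. a x) \<le> (\<Sum>x\<in>X. a x)"
        using S fin(1) by (intro sum_mono2) auto
      also have "\<dots> = (\<Sum>y\<in>Y. b y)"
        using R by blast
      also have "\<dots> = (\<Sum>y\<in>Y. min ?k (b y))"
        using b 3 by (intro sum.cong) (auto simp: min_def dest!: b)
      finally show ?thesis .
    qed
  qed
  then show ?L
    using R gale_ryser[OF fin disj] by blast
qed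

text \<open>Each class of elements with key \<open>\<kappa>\<close> is exactly as large as the labels with key \<open>\<kappa>\<close> require, so
labels can be handed out one element at a time.\<close>

lemma ex_assignment_with_fibres:
  fixes x :: "'b \<Rightarrow> nat"
  assumes "finite V" "finite L"
    and "\<And>\<kappa>. (\<Sum>l | l \<in> L \<and> key l = \<kappa>. x l) = card {v \<in> V. h v = \<kappa>}"
  shows "\<exists>g. (\<forall>v\<in>V. g v \<in> L \<and> key (g v) = h v) \<and> (\<forall>l\<in>L. card {v \<in> V. g v = l} = x l)"
  using assms(1,3)
proof (induction V arbitrary: x)
  case empty
  have "x l = 0" if "l \<in> L" for l
    using empty[of "key l"] assms(2) that by auto
  then show ?case by simp
next
  case (insert v V)
  have "(\<Sum>l | l \<in> L \<and> key l = h v. x l) \<noteq> 0"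
    using insert.prems[of "h v"] insert.hyps(1) by (auto simp: card_eq_0_iff)
  then obtain l0 where l0: "l0 \<in> L" "key l0 = h v" "x l0 \<noteq> 0"
    by (metis (mono_tags, lifting) mem_Collect_eq sum.neutral)
  define x' where "x' = x(l0 := x l0 - 1)"
  have x: "x l = x' l + of_bool (l = l0)" for l
    using l0(3) by (simp add: x'_def)
  have "(\<Sum>l | l \<in> L \<and> key l = \<kappa>. x' l) = card {u \<in> V. h u = \<kappa>}" for \<kappa>
  proof -
    have "(\<Sum>l | l \<in> L \<and> key l = \<kappa>. x l) =
        (\<Sum>l | l \<in> L \<and> key l = \<kappa>. x' l) + of_bool (h v = \<kappa>)"
    proof -
      have "{l \<in> L. key l = \<kappa>} \<inter> {l. l = l0} = (if h v = \<kappa> then {l0} else {})"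
        using l0 by auto
      then show ?thesis
        using assms(2) l0 by (auto simp: x sum.distrib of_bool_def sum.If_cases)
    qed
    moreover have "card {u \<in> insert v V. h u = \<kappa>} = card {u \<in> V. h u = \<kappa>} + of_bool (h v = \<kappa>)"
    proof -
      have "{u \<in> insert v V. h u = \<kappa>} =
          (if h v = \<kappa> then insert v {u \<in> V. h u = \<kappa>} else {u \<in> V. h u = \<kappa>})"
        by auto
      then show ?thesis
        using insert.hyps by simp
    qed
    ultimately show ?thesis
      using insert.prems[of \<kappa>] by simp
  qed
  then obtain g where g: "\<forall>u\<in>V. g u \<in> L \<and> key (g u) = h u" "\<forall>l\<in>L. card {u \<in> V. g u = l} = x' l"
    using insert.IH[of x'] by blast
  show ?case
  proof (intro exI[of _ "g(v := l0)"] conjI ballI)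
    fix u assume "u \<in> insert v V"
    then show "(g(v := l0)) u \<in> L" "key ((g(v := l0)) u) = h u"
      using g(1) l0 by auto
  next
    fix l assume l: "l \<in> L"
    have "{u \<in> insert v V. (g(v := l0)) u = l} =
        (if l = l0 then insert v {u \<in> V. g u = l} else {u \<in> V. g u = l})"
      using insert.hyps(2) by auto
    then show "card {u \<in> insert v V. (g(v := l0)) u = l} = x l"
      using bspec[OF g(2) l] insert.hyps by (auto simp: x)
  qed
qed

section \<open>Splitting a graph by the degrees of its vertices\<close>

lemma count_image_mset_set:
  assumes "finite A"
  shows "count (image_mset f (mset_set A)) j = card {w \<in> A. f w = j}"
proof -
  have "f -` {j} \<inter> A = {w \<in> A. f w = j}" by blast
  then show ?thesis
    using assms by (simp add: count_image_mset)
qed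

definition degree_class :: "nat list \<Rightarrow> nat \<Rightarrow> nat set" where
  "degree_class D i = {v. v < length D \<and> D ! v = i}"

lemma finite_degree_class [simp]: "finite (degree_class D i)"
  by (simp add: degree_class_def)

text \<open>The witness \<open>\<mu> v\<close> is the multiset of neighbor degrees; the required graphs are the parts of the
given graph between two degree classes or inside one.\<close>

lemma realizable_imp_local_partitions:
  assumes D: "\<And>v. v < length D \<Longrightarrow> D ! v \<in> {1..\<Delta>}"
    and "simple_graph_realizable D F"
  shows "\<exists>\<mu>. (\<forall>v<length D. \<mu> v \<in> partitions \<Delta> \<and> size (\<mu> v) = D ! v \<and> sum_mset (\<mu> v) = F ! v) \<and>
    (\<forall>i j. i \<noteq> j \<longrightarrow> bigraphic (degree_class D i) (degree_class D j)
       (\<lambda>v. count (\<mu> v) j) (\<lambda>v. count (\<mu> v) i)) \<and>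
    (\<forall>i. graphic (degree_class D i) (\<lambda>v. count (\<mu> v) i))"
proof -
  obtain E where E: "simple_graph (length D) E" and deg: "\<And>v. v < length D \<Longrightarrow> degree E v = D ! v"
    and F: "\<And>v. v < length D \<Longrightarrow> (\<Sum>w\<in>neighbors E v. degree E w) = F ! v"
    using assms(2) by (auto simp: simple_graph_realizable_def)
  have graph: "graph_on {..<length D} E"
    using E by (simp add: simple_graph_def graph_on_def)
  have finN: "finite (neighbors E v)" for v
    using graph_on_finite(2)[OF graph] by simp
  have nb: "w < length D" if "w \<in> neighbors E v" for v w
    using graph_on_neighbors[OF graph] that by blast
  define \<mu> where "\<mu> v = image_mset (degree E) (mset_set (neighbors E v))" for v
  have count: "count (\<mu> v) j = card (neighbors E v \<inter> degree_class D j)" for v j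
  proof -
    have "{w \<in> neighbors E v. degree E w = j} = neighbors E v \<inter> degree_class D j"
      using nb deg by (auto simp: degree_class_def)
    then show ?thesis
      using finN by (simp add: \<mu>_def count_image_mset_set)
  qed
  show ?thesis
  proof (intro exI[of _ \<mu>] conjI allI impI)
    fix v assume v: "v < length D"
    show "size (\<mu> v) = D ! v"
      using deg[OF v] by (simp add: \<mu>_def degree_def)
    show "sum_mset (\<mu> v) = F ! v"
      using F[OF v] by (simp add: \<mu>_def sum_unfold_sum_mset)
    have "a \<in> {1..\<Delta>}" if "a \<in># \<mu> v" for a
      using that finN nb deg D by (auto simp: \<mu>_def)
    then show "\<mu> v \<in> partitions \<Delta>"
      using \<open>size (\<mu> v) = D ! v\<close> D[OF v] by (auto simp: partitions_def)
  next
    fix i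
    let ?E = "{e \<in> E. e \<subseteq> degree_class D i}"
    have "degree ?E v = count (\<mu> v) i" if "v \<in> degree_class D i" for v
    proof -
      have "neighbors ?E v = neighbors E v \<inter> degree_class D i"
        using that by (auto simp: neighbors_def)
      then show ?thesis by (simp add: degree_def count)
    qed
    moreover have "graph_on (degree_class D i) ?E"
      using graph by (auto simp: graph_on_def)
    ultimately show "graphic (degree_class D i) (\<lambda>v. count (\<mu> v) i)"
      by (auto simp: graphic_def)
  next
    fix i j :: nat assume "i \<noteq> j"
    then have disj: "degree_class D i \<inter> degree_class D j = {}"
      by (auto simp: degree_class_def)
    let ?E = "{e \<in> E. \<exists>x\<in>degree_class D i. \<exists>y\<in>degree_class D j. e = {x, y}}"
    have "degree ?E v = count (\<mu> v) j" if "v \<in> degree_class D i" for v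
    proof -
      have "neighbors ?E v = neighbors E v \<inter> degree_class D j"
        using that disj by (auto simp: neighbors_def doubleton_eq_iff)
      then show ?thesis by (simp add: degree_def count)
    qed
    moreover have "degree ?E v = count (\<mu> v) i" if "v \<in> degree_class D j" for v
    proof -
      have "neighbors ?E v = neighbors E v \<inter> degree_class D i"
        using that disj by (auto simp: neighbors_def doubleton_eq_iff)
      then show ?thesis by (simp add: degree_def count)
    qed
    moreover have "bipartite_on (degree_class D i) (degree_class D j) ?E"
      by (auto simp: bipartite_on_def)
    ultimately show "bigraphic (degree_class D i) (degree_class D j)
       (\<lambda>v. count (\<mu> v) j) (\<lambda>v. count (\<mu> v) i)"
      by (auto simp: bigraphic_def)
  qed
qed

text \<open>The union of the graphs for all pairs of classes. An edge determines the classes of its endpoints,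
hence the only graph of the family that can contain it, so the neighbors of \<open>v\<close> in each
class are those of the respective graph. Their number is the multiplicity in \<open>\<mu> v\<close> of the degree of
that class, so \<open>\<mu> v\<close> is the multiset of neighbor degrees, which determines the degree and the neighbor
degree of \<open>v\<close>.\<close>

lemma local_partitions_imp_realizable:
  assumes D: "\<And>v. v < length D \<Longrightarrow> D ! v \<in> {1..\<Delta>}"
    and \<mu>: "\<And>v. v < length D \<Longrightarrow> \<mu> v \<in> partitions \<Delta> \<and> size (\<mu> v) = D ! v \<and> sum_mset (\<mu> v) = F ! v"
    and GR: "\<And>i j. 1 \<le> i \<Longrightarrow> i < j \<Longrightarrow> j \<le> \<Delta> \<Longrightarrow> bigraphic (degree_class D i) (degree_class D j)
       (\<lambda>v. count (\<mu> v) j) (\<lambda>v. count (\<mu> v) i)"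
    and EG: "\<And>i. i \<in> {1..\<Delta>} \<Longrightarrow> graphic (degree_class D i) (\<lambda>v. count (\<mu> v) i)"
  shows "simple_graph_realizable D F"
proof -
  let ?C = "degree_class D"
  have disj: "?C i \<inter> ?C j = {}" if "i \<noteq> j" for i j
    using that by (auto simp: degree_class_def)
  have cover: "v \<in> ?C (D ! v)" if "v < length D" for v
    using that by (simp add: degree_class_def)
  \<comment> \<open>Treats the simple graph inside a class (\<open>i = j\<close>) and the bipartite graph between two uniformly.\<close>
  define good where "good i j H \<longleftrightarrow>
    (\<forall>e\<in>H. \<exists>x\<in>?C i. \<exists>y\<in>?C j. e = {x, y} \<and> x \<noteq> y) \<and>
    (\<forall>v\<in>?C i. degree H v = count (\<mu> v) j) \<and> (\<forall>v\<in>?C j. degree H v = count (\<mu> v) i)" for i j H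
  have good_ex: "\<exists>H. good i j H" if ij: "1 \<le> i" "i \<le> j" "j \<le> \<Delta>" for i j
  proof (cases "i = j")
    case True
    obtain H where H: "graph_on (?C i) H" "\<forall>v\<in>?C i. degree H v = count (\<mu> v) i"
      using EG[of i] ij True by (auto simp: graphic_def)
    have "\<exists>x\<in>?C i. \<exists>y\<in>?C i. e = {x, y} \<and> x \<noteq> y" if "e \<in> H" for e
    proof -
      have "card e = 2" "e \<subseteq> ?C i"
        using H(1) that by (auto simp: graph_on_def)
      then show ?thesis
        unfolding card_2_iff by blast
    qed
    then show ?thesis
      using H True unfolding good_def by blast
  next
    case False
    then obtain H where H: "bipartite_on (?C i) (?C j) H" "\<forall>v\<in>?C i. degree H v = count (\<mu> v) j"
      "\<forall>v\<in>?C j. degree H v = count (\<mu> v) i"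
      using GR[of i j] ij by (auto simp: bigraphic_def)
    have "\<exists>x\<in>?C i. \<exists>y\<in>?C j. e = {x, y} \<and> x \<noteq> y" if eH: "e \<in> H" for e
    proof -
      obtain x y where "x \<in> ?C i" "y \<in> ?C j" "e = {x, y}"
        using H(1) eH by (auto simp: bipartite_on_def)
      moreover from this have "x \<noteq> y"
        using disj[OF False] by blast
      ultimately show ?thesis by blast
    qed
    then show ?thesis
      using H unfolding good_def by blast
  qed
  define G where "G i j = (SOME H. good i j H)" for i j
  have G: "good i j (G i j)" if "1 \<le> i" "i \<le> j" "j \<le> \<Delta>" for i j
    using good_ex[OF that] unfolding G_def by (rule someI_ex)
  define E where "E = (\<Union>j\<in>{1..\<Delta>}. \<Union>i\<in>{1..j}. G i j)"
  have edge_D: "\<exists>x\<in>?C i. \<exists>y\<in>?C j. e = {x, y} \<and> x \<noteq> y" if "e \<in> G i j" "1 \<le> i" "i \<le> j" "j \<le> \<Delta>" for e i j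
    using G[OF that(2-4)] that(1) unfolding good_def by blast
  have graph: "graph_on {..<length D} E"
    unfolding graph_on_def
  proof
    fix e assume "e \<in> E"
    then obtain i j where "e \<in> G i j" "1 \<le> i" "i \<le> j" "j \<le> \<Delta>"
      by (auto simp: E_def)
    then obtain x y where "x \<in> ?C i" "y \<in> ?C j" "e = {x, y}" "x \<noteq> y"
      using edge_D by blast
    then show "e \<subseteq> {..<length D} \<and> card e = 2"
      by (auto simp: degree_class_def)
  qed
  have finN: "finite (neighbors E v)" for v
    using graph_on_finite(2)[OF graph] by simp
  have nb: "w < length D" if "w \<in> neighbors E v" for v w
    using graph_on_neighbors[OF graph] that by blast
  have G_cover: "{v, w} \<in> E \<longleftrightarrow> {v, w} \<in> G i j" if "v \<in> ?C i" "w \<in> ?C j" "1 \<le> i" "i \<le> j" "j \<le> \<Delta>" for v w i j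
  proof
    assume "{v, w} \<in> E"
    then obtain i' j' where e: "{v, w} \<in> G i' j'" "1 \<le> i'" "i' \<le> j'" "j' \<le> \<Delta>"
      by (auto simp: E_def)
    then have "v \<in> ?C i' \<and> w \<in> ?C j' \<or> w \<in> ?C i' \<and> v \<in> ?C j'"
      using edge_D[OF e] by (auto simp: doubleton_eq_iff)
    then have "i' = i \<and> j' = j"
      using that e by (auto simp: degree_class_def)
    then show "{v, w} \<in> G i j"
      using e by simp
  next
    assume "{v, w} \<in> G i j"
    then show "{v, w} \<in> E"
      unfolding E_def using that by (intro UN_I[of j] UN_I[of i]) auto
  qed
  have count: "card (neighbors E v \<inter> ?C j) = count (\<mu> v) j" if v: "v < length D" and j: "j \<in> {1..\<Delta>}" for v j
  proof -
    let ?i = "D ! v"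
    have i: "1 \<le> ?i" "?i \<le> \<Delta>" using D[OF v] by auto
    define H where "H = (if ?i \<le> j then G ?i j else G j ?i)"
    have "neighbors H v \<subseteq> ?C j"
      using edge_D[of _ ?i j] edge_D[of _ j ?i] i j cover[OF v] disj[of ?i j]
      unfolding H_def neighbors_def by (fastforce simp: doubleton_eq_iff split: if_splits)
    moreover have "w \<in> neighbors E v \<longleftrightarrow> w \<in> neighbors H v" if "w \<in> ?C j" for w
      using G_cover[OF cover[OF v] that] G_cover[OF that cover[OF v]] i j
      by (auto simp: neighbors_def H_def insert_commute)
    ultimately have "neighbors E v \<inter> ?C j = neighbors H v"
      by blast
    moreover have "degree H v = count (\<mu> v) j"
      using G[of ?i j] G[of j ?i] i j cover[OF v] unfolding H_def good_def
      by (cases "?i \<le> j") auto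
    ultimately show ?thesis by (simp add: degree_def)
  qed
  have nbhd: "image_mset ((!) D) (mset_set (neighbors E v)) = \<mu> v" if v: "v < length D" for v
  proof (rule multiset_eqI)
    fix j
    have set: "{w \<in> neighbors E v. D ! w = j} = neighbors E v \<inter> ?C j"
      using nb by (auto simp: degree_class_def)
    have "count (image_mset ((!) D) (mset_set (neighbors E v))) j = card (neighbors E v \<inter> ?C j)"
      using finN by (simp add: count_image_mset_set set)
    also have "\<dots> = count (\<mu> v) j"
    proof (cases "j \<in> {1..\<Delta>}")
      case False
      have "?C j = {}"
        using D False by (auto simp: degree_class_def)
      moreover have "count (\<mu> v) j = 0"
        using \<mu>[OF v] False unfolding not_in_iff[symmetric] by (auto simp: partitions_def)
      ultimately show ?thesis by simp
    qed (rule count[OF v])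
    finally show "count (image_mset ((!) D) (mset_set (neighbors E v))) j = count (\<mu> v) j" .
  qed
  have deg: "degree E v = D ! v" if v: "v < length D" for v
    using arg_cong[OF nbhd[OF v], of size] \<mu>[OF v] by (simp add: degree_def)
  have "(\<Sum>w\<in>neighbors E v. degree E w) = F ! v" if v: "v < length D" for v
  proof -
    have "(\<Sum>w\<in>neighbors E v. degree E w) = (\<Sum>w\<in>neighbors E v. D ! w)"
      using deg nb by (intro sum.cong) auto
    also have "\<dots> = F ! v"
      using arg_cong[OF nbhd[OF v], of sum_mset] \<mu>[OF v] by (simp add: sum_unfold_sum_mset)
    finally show ?thesis .
  qed
  then show ?thesis
    using graph deg by (auto simp: simple_graph_realizable_def simple_graph_def graph_on_def)
qed

section \<open>Realizability in terms of partition multiplicities\<close>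

lemma finite_partitions: "finite (partitions \<Delta>)"
proof -
  have "partitions \<Delta> \<subseteq> mset ` {xs. set xs \<subseteq> {1..\<Delta>} \<and> length xs \<le> \<Delta>}"
  proof
    fix \<mu> assume "\<mu> \<in> partitions \<Delta>"
    moreover obtain xs where "mset xs = \<mu>"
      using ex_mset by blast
    ultimately show "\<mu> \<in> mset ` {xs. set xs \<subseteq> {1..\<Delta>} \<and> length xs \<le> \<Delta>}"
      by (intro image_eqI[of _ _ xs]) (auto simp: partitions_def)
  qed
  then show ?thesis
    using finite_lists_length_le[of "{1..\<Delta>}" \<Delta>] finite_subset by blast
qed

lemma finite_partitions_height [simp]: "finite (partitions_height \<Delta> i)"
  using finite_partitions by (simp add: partitions_height_def)

text \<open>The value of \<open>s\<^sup>i\<^sup>j\<^sub>l\<close>.\<close>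

definition level_count :: "nat \<Rightarrow> (nat multiset \<Rightarrow> nat) \<Rightarrow> nat \<Rightarrow> nat \<Rightarrow> nat \<Rightarrow> nat" where
  "level_count \<Delta> x i j l = (\<Sum>\<mu> | \<mu> \<in> partitions_height \<Delta> i \<and> count \<mu> j = l. x \<mu>)"

text \<open>The program with its recursion variables eliminated: each is replaced by the \<open>greedy\<close> value
that it stands for. Parity replaces the variables \<open>p_var i\<close>, and the subtraction in the
Erdos-Gallai inequality has moved to the other side, as the numbers are natural.\<close>

definition solves :: "nat \<Rightarrow> nat list \<Rightarrow> nat list \<Rightarrow> (nat multiset \<Rightarrow> nat) \<Rightarrow> bool" where
  "solves \<Delta> D F x \<longleftrightarrow>
    (\<forall>d f. (\<Sum>\<mu> | \<mu> \<in> partitions_height \<Delta> d \<and> sum_mset \<mu> = f. x \<mu>) =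
       card {i. i < length D \<and> D ! i = d \<and> F ! i = f}) \<and>
    (\<forall>j\<in>{1..\<Delta>}. \<forall>i\<in>{1..<j}.
       (\<Sum>\<mu>\<in>partitions_height \<Delta> i. count \<mu> j * x \<mu>) =
         (\<Sum>\<mu>\<in>partitions_height \<Delta> j. count \<mu> i * x \<mu>) \<and>
       (\<forall>k\<in>{1..\<Delta> - 1}. greedy (\<lambda>r. r) (level_count \<Delta> x i j) i k \<le>
         (\<Sum>\<mu>\<in>partitions_height \<Delta> j. min k (count \<mu> i) * x \<mu>))) \<and>
    (\<forall>i\<in>{1..\<Delta>}.
       even (\<Sum>\<mu>\<in>partitions_height \<Delta> i. count \<mu> i * x \<mu>) \<and>
       (\<forall>k\<in>{1..\<Delta>}. greedy (\<lambda>r. r) (level_count \<Delta> x i i) i k +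
           greedy (\<lambda>r. min r k) (level_count \<Delta> x i i) i k \<le>
         k * (k - 1) + (\<Sum>\<mu>\<in>partitions_height \<Delta> i. min k (count \<mu> i) * x \<mu>)))"

definition assigned :: "nat \<Rightarrow> nat list \<Rightarrow> nat list \<Rightarrow> (nat \<Rightarrow> nat multiset) \<Rightarrow> (nat multiset \<Rightarrow> nat) \<Rightarrow> bool"
  where "assigned \<Delta> D F \<mu> x \<longleftrightarrow>
    (\<forall>v<length D. \<mu> v \<in> partitions \<Delta> \<and> size (\<mu> v) = D ! v \<and> sum_mset (\<mu> v) = F ! v) \<and>
    (\<forall>\<pi>\<in>partitions \<Delta>. x \<pi> = card {v. v < length D \<and> \<mu> v = \<pi>})"

text \<open>Vertices and partitions are matched by the key (degree, neighbor degree) and (size, sum).\<close>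

lemma solves_imp_assigned:
  assumes "solves \<Delta> D F x"
  shows "\<exists>\<mu>. assigned \<Delta> D F \<mu> x"
proof -
  have "(\<Sum>l | l \<in> partitions \<Delta> \<and> (size l, sum_mset l) = \<kappa>. x l) =
      card {v \<in> {..<length D}. (D ! v, F ! v) = \<kappa>}" for \<kappa>
  proof (cases \<kappa>)
    case (Pair d f)
    have "{l. l \<in> partitions \<Delta> \<and> (size l, sum_mset l) = \<kappa>} =
        {l. l \<in> partitions_height \<Delta> d \<and> sum_mset l = f}"
      by (auto simp: Pair partitions_height_def)
    moreover have "{v \<in> {..<length D}. (D ! v, F ! v) = \<kappa>} = {v. v < length D \<and> D ! v = d \<and> F ! v = f}"
      by (auto simp: Pair)
    ultimately show ?thesis
      using assms by (simp add: solves_def)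
  qed
  from ex_assignment_with_fibres[OF _ finite_partitions this] obtain \<mu> where
    "\<forall>v\<in>{..<length D}. \<mu> v \<in> partitions \<Delta> \<and> (size (\<mu> v), sum_mset (\<mu> v)) = (D ! v, F ! v)"
    "\<forall>l\<in>partitions \<Delta>. card {v \<in> {..<length D}. \<mu> v = l} = x l"
    by auto
  then show ?thesis
    by (intro exI[of _ \<mu>]) (auto simp: assigned_def)
qed

text \<open>Sums over partitions weighted by \<open>x\<close> are sums over vertices. This turns every linear expression of
the program into a statement about the degree classes.\<close>

lemma sum_assigned:
  assumes "assigned \<Delta> D F \<mu> x"
  shows "(\<Sum>\<pi>\<in>partitions_height \<Delta> i. g \<pi> * x \<pi>) = (\<Sum>v\<in>degree_class D i. g (\<mu> v))"
proof -
  have in_height: "\<mu> v \<in> partitions_height \<Delta> i \<longleftrightarrow> v \<in> degree_class D i" if "v < length D" for v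
    using assms that by (auto simp: assigned_def partitions_height_def degree_class_def)
  have "(\<Sum>v\<in>degree_class D i. g (\<mu> v)) =
      (\<Sum>\<pi>\<in>partitions_height \<Delta> i. \<Sum>v | v \<in> degree_class D i \<and> \<mu> v = \<pi>. g (\<mu> v))"
    using in_height by (intro sum.group[symmetric]) (auto simp: degree_class_def)
  also have "\<dots> = (\<Sum>\<pi>\<in>partitions_height \<Delta> i. g \<pi> * x \<pi>)"
  proof (rule sum.cong)
    fix \<pi> assume l: "\<pi> \<in> partitions_height \<Delta> i"
    have "{v. v \<in> degree_class D i \<and> \<mu> v = \<pi>} = {v. v < length D \<and> \<mu> v = \<pi>}"
      using in_height l by (auto simp: degree_class_def)
    moreover have "x \<pi> = card {v. v < length D \<and> \<mu> v = \<pi>}"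
      using assms l by (simp add: assigned_def partitions_height_def)
    ultimately show "(\<Sum>v | v \<in> degree_class D i \<and> \<mu> v = \<pi>. g (\<mu> v)) = g \<pi> * x \<pi>"
      by simp
  qed simp
  finally show ?thesis by simp
qed

lemma sum_assigned_filter:
  assumes "assigned \<Delta> D F \<mu> x"
  shows "(\<Sum>\<pi> | \<pi> \<in> partitions_height \<Delta> i \<and> Q \<pi>. x \<pi>) = card {v \<in> degree_class D i. Q (\<mu> v)}"
proof -
  have "(\<Sum>\<pi> | \<pi> \<in> partitions_height \<Delta> i \<and> Q \<pi>. x \<pi>) =
      (\<Sum>\<pi>\<in>partitions_height \<Delta> i. of_bool (Q \<pi>) * x \<pi>)"
    by (intro sum.mono_neutral_cong_left) auto
  also have "\<dots> = (\<Sum>v\<in>degree_class D i. of_bool (Q (\<mu> v)))"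
    by (rule sum_assigned[OF assms])
  also have "\<dots> = card {v \<in> degree_class D i. Q (\<mu> v)}"
    by (simp add: of_bool_def sum.If_cases Collect_conj_eq)
  finally show ?thesis .
qed

lemma solves_iff_graphic:
  assumes asg: "assigned \<Delta> D F \<mu> x"
  shows "solves \<Delta> D F x \<longleftrightarrow>
    (\<forall>j\<in>{1..\<Delta>}. \<forall>i\<in>{1..<j}. bigraphic (degree_class D i) (degree_class D j)
       (\<lambda>v. count (\<mu> v) j) (\<lambda>v. count (\<mu> v) i)) \<and>
    (\<forall>i\<in>{1..\<Delta>}. graphic (degree_class D i) (\<lambda>v. count (\<mu> v) i))"
proof -
  have count_le: "count (\<mu> v) j \<le> i" if "v \<in> degree_class D i" for v i j
    using asg that count_le_size[of "\<mu> v" j] by (auto simp: assigned_def degree_class_def)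
  have level: "level_count \<Delta> x i j r = card {v \<in> degree_class D i. count (\<mu> v) j = r}" for i j r
    unfolding level_count_def by (rule sum_assigned_filter[OF asg])
  have "(\<Sum>\<mu> | \<mu> \<in> partitions_height \<Delta> d \<and> sum_mset \<mu> = f. x \<mu>) =
      card {i. i < length D \<and> D ! i = d \<and> F ! i = f}" for d f
  proof -
    have "{v \<in> degree_class D d. sum_mset (\<mu> v) = f} = {i. i < length D \<and> D ! i = d \<and> F ! i = f}"
      using asg by (auto simp: assigned_def degree_class_def)
    then show ?thesis
      by (simp add: sum_assigned_filter[OF asg])
  qed
  moreover have "bigraphic (degree_class D i) (degree_class D j)
       (\<lambda>v. count (\<mu> v) j) (\<lambda>v. count (\<mu> v) i) \<longleftrightarrow>
       (\<Sum>\<mu>\<in>partitions_height \<Delta> i. count \<mu> j * x \<mu>) =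
         (\<Sum>\<mu>\<in>partitions_height \<Delta> j. count \<mu> i * x \<mu>) \<and>
       (\<forall>k\<in>{1..\<Delta> - 1}. greedy (\<lambda>r. r) (level_count \<Delta> x i j) i k \<le>
         (\<Sum>\<mu>\<in>partitions_height \<Delta> j. min k (count \<mu> i) * x \<mu>))"
    if ij: "j \<in> {1..\<Delta>}" "i \<in> {1..<j}" for i j
    unfolding sum_assigned[OF asg]
  proof (rule bigraphic_iff_greedy)
    show "degree_class D i \<inter> degree_class D j = {}"
      using ij by (auto simp: degree_class_def)
    show "count (\<mu> y) i \<le> \<Delta>" if "y \<in> degree_class D j" for y
      using count_le[OF that, of i] ij by simp
  qed (use count_le level in auto)
  moreover have "graphic (degree_class D i) (\<lambda>v. count (\<mu> v) i) \<longleftrightarrow>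
       even (\<Sum>\<mu>\<in>partitions_height \<Delta> i. count \<mu> i * x \<mu>) \<and>
       (\<forall>k\<in>{1..\<Delta>}. greedy (\<lambda>r. r) (level_count \<Delta> x i i) i k +
           greedy (\<lambda>r. min r k) (level_count \<Delta> x i i) i k \<le>
         k * (k - 1) + (\<Sum>\<mu>\<in>partitions_height \<Delta> i. min k (count \<mu> i) * x \<mu>))"
    if "i \<in> {1..\<Delta>}" for i
    unfolding sum_assigned[OF asg]
    by (rule graphic_iff_greedy) (use count_le level that in auto)
  ultimately show ?thesis
    unfolding solves_def by simp
qed

lemma realizable_iff_solves:
  assumes D: "\<And>v. v < length D \<Longrightarrow> D ! v \<in> {1..\<Delta>}"
  shows "simple_graph_realizable D F \<longleftrightarrow> (\<exists>x. solves \<Delta> D F x)"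
proof
  assume "simple_graph_realizable D F"
  then obtain \<mu> where \<mu>:
    "\<forall>v<length D. \<mu> v \<in> partitions \<Delta> \<and> size (\<mu> v) = D ! v \<and> sum_mset (\<mu> v) = F ! v"
    and bi: "\<And>i j. i \<noteq> j \<Longrightarrow> bigraphic (degree_class D i) (degree_class D j)
       (\<lambda>v. count (\<mu> v) j) (\<lambda>v. count (\<mu> v) i)"
    and gr: "\<And>i. graphic (degree_class D i) (\<lambda>v. count (\<mu> v) i)"
    using realizable_imp_local_partitions[OF D] by blast
  have "assigned \<Delta> D F \<mu> (\<lambda>\<pi>. card {v. v < length D \<and> \<mu> v = \<pi>})"
    using \<mu> by (simp add: assigned_def)
  from solves_iff_graphic[OF this] show "\<exists>x. solves \<Delta> D F x"
    using bi gr by (intro exI[of _ "\<lambda>\<pi>. card {v. v < length D \<and> \<mu> v = \<pi>}"]) auto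
next
  assume "\<exists>x. solves \<Delta> D F x"
  then obtain x \<mu> where "solves \<Delta> D F x" and asg: "assigned \<Delta> D F \<mu> x"
    using solves_imp_assigned by blast
  then show "simple_graph_realizable D F"
    using solves_iff_graphic[OF asg]
    by (intro local_partitions_imp_realizable[OF D, of \<mu>]) (auto simp: assigned_def)
qed

text \<open>One of the two bounds on compared values that make \<open>M\<close> large enough; the other is \<open>greedy_le\<close>.\<close>

lemma level_count_le:
  assumes "solves \<Delta> D F x"
  shows "level_count \<Delta> x i j l \<le> length D"
proof -
  obtain \<mu> where "assigned \<Delta> D F \<mu> x"
    using solves_imp_assigned[OF assms] by blast
  then have "level_count \<Delta> x i j l = card {v \<in> degree_class D i. count (\<mu> v) j = l}"
    unfolding level_count_def by (rule sum_assigned_filter)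
  also have "\<dots> \<le> card {..<length D}"
    by (intro card_mono) (auto simp: degree_class_def)
  finally show ?thesis by simp
qed

section \<open>Semantics of linear constraint systems\<close>

text \<open>Summing over the keys makes the value of an expression independent of any set of variables. For the
system of an \<open>ip_problem\<close>, it agrees with the sum over all variables in \<open>ip_feasible\<close>.\<close>

definition val :: "('v \<Rightarrow> int) \<Rightarrow> 'v lin_exp \<Rightarrow> int" where
  "val \<sigma> e = (\<Sum>v\<in>Poly_Mapping.keys (fst e). Poly_Mapping.lookup (fst e) v * \<sigma> v) + snd e"

definition satisfies :: "('v \<Rightarrow> int) \<Rightarrow> 'v lin_ineq set \<Rightarrow> bool" where
  "satisfies \<sigma> L \<longleftrightarrow> (\<forall>(a, c)\<in>L. val \<sigma> (a, 0) \<le> c)"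

lemma val_superset:
  assumes "finite S" "Poly_Mapping.keys (fst e) \<subseteq> S"
  shows "val \<sigma> e = (\<Sum>v\<in>S. Poly_Mapping.lookup (fst e) v * \<sigma> v) + snd e"
proof -
  have "(\<Sum>v\<in>S. Poly_Mapping.lookup (fst e) v * \<sigma> v) =
      (\<Sum>v\<in>Poly_Mapping.keys (fst e). Poly_Mapping.lookup (fst e) v * \<sigma> v)"
    using assms by (intro sum.mono_neutral_right) (auto simp: in_keys_iff)
  then show ?thesis by (simp add: val_def)
qed

lemma val_Var [simp]: "val \<sigma> (Var v) = \<sigma> v"
  by (simp add: val_def Var_def)

lemma val_Const [simp]: "val \<sigma> (Const c) = c"
  by (simp add: val_def Const_def)

lemma val_add [simp]: "val \<sigma> (e + e') = val \<sigma> e + val \<sigma> e'"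
proof -
  let ?S = "Poly_Mapping.keys (fst e) \<union> Poly_Mapping.keys (fst e')"
  have "Poly_Mapping.keys (fst (e + e')) \<subseteq> ?S"
    by (simp add: Poly_Mapping.keys_add)
  then show ?thesis
    using val_superset[of ?S e \<sigma>] val_superset[of ?S e' \<sigma>] val_superset[of ?S "e + e'" \<sigma>]
    by (simp add: lookup_add distrib_right sum.distrib)
qed

lemma val_diff [simp]: "val \<sigma> (e - e') = val \<sigma> e - val \<sigma> e'"
  using val_add[of \<sigma> "e - e'" e'] by simp

lemma val_Scale [simp]: "val \<sigma> (Scale c e) = c * val \<sigma> e"
proof -
  let ?S = "Poly_Mapping.keys (fst e)"
  have "Poly_Mapping.keys (fst (Scale c e)) \<subseteq> ?S"
    by (simp add: Scale_def keys_cmul)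
  then show ?thesis
    using val_superset[of ?S e \<sigma>] val_superset[of ?S "Scale c e" \<sigma>]
    by (simp add: Scale_def distrib_left sum_distrib_left mult.assoc)
qed

lemma val_sum [simp]: "val \<sigma> (\<Sum>i\<in>I. g i) = (\<Sum>i\<in>I. val \<sigma> (g i))"
proof (induction I rule: infinite_finite_induct)
  case (infinite I)
  then show ?case by (simp add: val_def)
qed (auto simp: val_def[of _ 0])

lemma satisfies_simps [simp]:
  "satisfies \<sigma> {}"
  "satisfies \<sigma> (insert (leq e e') L) \<longleftrightarrow> val \<sigma> e \<le> val \<sigma> e' \<and> satisfies \<sigma> L"
  "satisfies \<sigma> (L \<union> L') \<longleftrightarrow> satisfies \<sigma> L \<and> satisfies \<sigma> L'"
  "satisfies \<sigma> (\<Union>i\<in>I. K i) \<longleftrightarrow> (\<forall>i\<in>I. satisfies \<sigma> (K i))"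
proof -
  have "val \<sigma> (fst e - fst e', 0) = val \<sigma> (e - e') - (snd e - snd e')"
    by (simp add: val_def)
  then have "val \<sigma> (fst e - fst e', 0) \<le> snd e' - snd e \<longleftrightarrow> val \<sigma> e \<le> val \<sigma> e'"
    by auto
  then show "satisfies \<sigma> (insert (leq e e') L) \<longleftrightarrow> val \<sigma> e \<le> val \<sigma> e' \<and> satisfies \<sigma> L"
    by (simp add: satisfies_def leq_def)
qed (auto simp: satisfies_def)

lemma satisfies_equ [simp]: "satisfies \<sigma> (equ e e') \<longleftrightarrow> val \<sigma> e = val \<sigma> e'"
  by (auto simp: equ_def)

lemma ip_feasible_iff_satisfies:
  assumes "ip_problem P"
  shows "ip_feasible P \<longleftrightarrow> (\<exists>\<sigma>. satisfies \<sigma> (snd P))"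
proof -
  have "(\<Sum>v\<in>fst P. Poly_Mapping.lookup a v * \<sigma> v) = val \<sigma> (a, 0)" if "(a, c) \<in> snd P" for a c and \<sigma>
    using assms that by (subst val_superset[of "fst P"]) (auto simp: ip_problem_def)
  then have "(\<forall>(a, c)\<in>snd P. (\<Sum>v\<in>fst P. Poly_Mapping.lookup a v * \<sigma> v) \<le> c) \<longleftrightarrow> satisfies \<sigma> (snd P)" for \<sigma>
    unfolding satisfies_def by (intro ball_cong) auto
  then show ?thesis
    unfolding ip_feasible_def by simp
qed

text \<open>Being \<open>0\<close> or \<open>1\<close>, the binary variable turns one of the two lower bounds of \<open>z\<close> into \<open>x\<close> or \<open>y\<close> itself.\<close>

lemma satisfies_min_constraints:
  assumes "satisfies \<sigma> (min_constraints M z b x y)"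
  shows "val \<sigma> z = min (val \<sigma> x) (val \<sigma> y)"
proof -
  have "val \<sigma> b = 0 \<or> val \<sigma> b = 1"
    using assms by (auto simp: min_constraints_def)
  then show ?thesis
    using assms by (auto simp: min_constraints_def)
qed

lemma satisfies_max_constraints:
  assumes "satisfies \<sigma> (max_constraints M z b x y)"
  shows "val \<sigma> z = max (val \<sigma> x) (val \<sigma> y)"
proof -
  have "val \<sigma> b = 0 \<or> val \<sigma> b = 1"
    using assms by (auto simp: max_constraints_def)
  then show ?thesis
    using assms by (auto simp: max_constraints_def)
qed

lemma min_constraintsI:
  assumes "val \<sigma> z = min (val \<sigma> x) (val \<sigma> y)" "val \<sigma> b = of_bool (val \<sigma> y < val \<sigma> x)"
    and "\<bar>val \<sigma> x - val \<sigma> y\<bar> \<le> M"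
  shows "satisfies \<sigma> (min_constraints M z b x y)"
  using assms by (auto simp: min_constraints_def min_def)

lemma max_constraintsI:
  assumes "val \<sigma> z = max (val \<sigma> x) (val \<sigma> y)" "val \<sigma> b = of_bool (val \<sigma> x < val \<sigma> y)"
    and "\<bar>val \<sigma> x - val \<sigma> y\<bar> \<le> M"
  shows "satisfies \<sigma> (max_constraints M z b x y)"
  using assms by (auto simp: max_constraints_def max_def)

lemma Max_image_Suc:
  fixes g :: "nat \<Rightarrow> 'a::linorder"
  shows "Max (g ` {0..Suc m}) = max (Max (g ` {0..m})) (g (Suc m))"
proof -
  have "g ` {0..Suc m} = insert (g (Suc m)) (g ` {0..m})"
    by (auto simp: atLeast0_atMost_Suc)
  then show ?thesis by (simp add: max.commute)
qed

lemma satisfies_max_chain: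
  assumes "satisfies \<sigma> (max_chain M z b c k)" "1 \<le> k"
  shows "val \<sigma> (z k) = Max ((\<lambda>k'. val \<sigma> (c k')) ` {0..k})"
proof -
  have step: "val \<sigma> (z m) = max (val \<sigma> (if m = 1 then c 0 else z (m - 1))) (val \<sigma> (c m))"
    if "m \<in> {1..k}" for m
    using assms(1) that unfolding max_chain_def satisfies_simps
    by (blast intro: satisfies_max_constraints)
  have "Suc m \<le> k \<Longrightarrow> val \<sigma> (z (Suc m)) = Max ((\<lambda>k'. val \<sigma> (c k')) ` {0..Suc m})" for m
  proof (induction m)
    case 0
    then show ?case
      using step[of 1] unfolding Max_image_Suc by simp
  next
    case (Suc m)
    then show ?case
      using step[of "Suc (Suc m)"] unfolding Max_image_Suc[of _ "Suc m"] by simp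
  qed
  from this[of "k - 1"] show ?thesis
    using assms(2) by simp
qed

text \<open>Nonnegative numbers up to \<open>M\<close> differ by at most \<open>M\<close>, and so do their maxima.\<close>

lemma max_chainI:
  assumes z: "\<And>m. m \<in> {1..k} \<Longrightarrow> val \<sigma> (z m) = Max ((\<lambda>k'. val \<sigma> (c k')) ` {0..m})"
    and b: "\<And>m. m \<in> {1..k} \<Longrightarrow>
      val \<sigma> (b m) = of_bool (Max ((\<lambda>k'. val \<sigma> (c k')) ` {0..m - 1}) < val \<sigma> (c m))"
    and bounds: "\<And>k'. k' \<le> k \<Longrightarrow> 0 \<le> val \<sigma> (c k') \<and> val \<sigma> (c k') \<le> M"
  shows "satisfies \<sigma> (max_chain M z b c k)"
  unfolding max_chain_def satisfies_simps
proof
  fix m assume m: "m \<in> {1..k}"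
  let ?g = "\<lambda>k'. val \<sigma> (c k')"
  define y where "y = Max (?g ` {0..m - 1})"
  have prev: "val \<sigma> (if m = 1 then c 0 else z (m - 1)) = y"
    using m z[of "m - 1"] unfolding y_def by (cases "m = 1") (auto simp: Suc_le_eq)
  have "y \<in> ?g ` {0..m - 1}"
    unfolding y_def by (intro Max_in) auto
  then have y: "0 \<le> y" "y \<le> M"
    using bounds m by fastforce+
  have gm: "0 \<le> ?g m" "?g m \<le> M"
    using bounds m by auto
  have "Max (?g ` {0..m}) = max y (?g m)"
    using Max_image_Suc[of ?g "m - 1"] m by (simp add: y_def)
  then have zm: "val \<sigma> (z m) = max y (?g m)"
    using z[OF m] by simp
  show "satisfies \<sigma> (max_constraints M (z m) (b m) (if m = 1 then c 0 else z (m - 1)) (c m))"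
    by (rule max_constraintsI; unfold prev) (use zm y gm b[OF m, folded y_def] in auto)
qed

section \<open>The constraint system and the recursions\<close>

text \<open>The term compared in the recursion for \<open>greedy w s l k\<close> when \<open>k'\<close> elements of level \<open>l\<close> are tried.\<close>

definition greedy_option :: "(nat \<Rightarrow> nat) \<Rightarrow> (nat \<Rightarrow> nat) \<Rightarrow> nat \<Rightarrow> nat \<Rightarrow> nat \<Rightarrow> nat" where
  "greedy_option w s l k k' = greedy w s (l - 1) (k - k') + w l * min k' (s l)"

lemma greedy_eq_Max_option:
  assumes "1 \<le> l"
  shows "greedy w s l k = Max (greedy_option w s l k ` {0..k})"
  using assms by (cases l) (auto simp: greedy_option_def image_def)

lemma greedy_zero [simp]: "greedy w s l 0 = 0"
  by (induction l) auto

lemma greedy_option_le: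
  assumes "\<And>r. w r \<le> r" "1 \<le> l" "k' \<le> k"
  shows "greedy_option w s l k k' \<le> l * k"
proof -
  have "greedy_option w s l k k' \<le> greedy w s l k"
    unfolding greedy_eq_Max_option[OF assms(2)] using assms(3) by (intro Max_ge) auto
  also have "\<dots> \<le> l * k"
    by (rule greedy_le[OF assms(1)])
  finally show ?thesis .
qed

lemma int_Max:
  assumes "finite A" "A \<noteq> {}"
  shows "int (Max A) = Max (int ` A)"
  using assms by (intro mono_Max_commute) (auto simp: mono_def)

text \<open>Stated for an arbitrary weight and family \<open>T\<close> of expressions, so that it applies to both families
of recursion variables; for the second one, \<open>K\<close> is the parameter of the inequality, which also
bounds the running index.\<close>

lemma greedy_recursion_sound:
  assumes zero: "\<And>q. val \<sigma> (T 0 q) = 0" "\<And>l. val \<sigma> (T l 0) = 0"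
    and m: "\<And>l k'. l \<in> {1..L} \<Longrightarrow> k' \<le> K \<Longrightarrow> val \<sigma> (m l k') = int (min k' (s l))"
    and chain: "\<And>l q. l \<in> {1..L} \<Longrightarrow> q \<in> {1..K} \<Longrightarrow>
      satisfies \<sigma> (max_chain M (z l q) (b l q)
        (\<lambda>k'. T (l - 1) (q - k') + Scale (int (w l)) (m l k')) q)"
    and T: "\<And>l q. l \<in> {1..L} \<Longrightarrow> q \<in> {1..K} \<Longrightarrow> val \<sigma> (T l q) = val \<sigma> (z l q q)"
  shows "l \<le> L \<Longrightarrow> q \<le> K \<Longrightarrow> val \<sigma> (T l q) = int (greedy w s l q)"
proof (induction l arbitrary: q)
  case 0
  then show ?case by (simp add: zero)
next
  case (Suc l)
  show ?case
  proof (cases "q = 0")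
    case True
    then show ?thesis by (simp add: zero)
  next
    case False
    then have lq: "Suc l \<in> {1..L}" "q \<in> {1..K}"
      using Suc.prems by auto
    have "val \<sigma> (T (Suc l) q) = Max ((\<lambda>k'. val \<sigma> (T l (q - k') + Scale (int (w (Suc l))) (m (Suc l) k'))) ` {0..q})"
      using satisfies_max_chain[OF chain[OF lq]] T[OF lq] lq(2) by simp
    also have "(\<lambda>k'. val \<sigma> (T l (q - k') + Scale (int (w (Suc l))) (m (Suc l) k'))) ` {0..q} =
        (\<lambda>k'. int (greedy_option w s (Suc l) q k')) ` {0..q}"
      using Suc.IH Suc.prems m[OF lq(1)] by (intro image_cong) (auto simp: greedy_option_def)
    also have "Max \<dots> = int (greedy w s (Suc l) q)"
      by (subst greedy_eq_Max_option) (auto simp: int_Max image_image)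
    finally show ?thesis .
  qed
qed

lemma greedy_recursion_complete:
  assumes "\<And>r. w r \<le> r" and M: "int (L * K) \<le> M"
    and l: "l \<in> {1..L}" and q: "q \<in> {1..K}"
    and T: "\<And>q. q \<le> K \<Longrightarrow> val \<sigma> (T (l - 1) q) = int (greedy w s (l - 1) q)"
    and m: "\<And>k'. k' \<le> K \<Longrightarrow> val \<sigma> (m k') = int (min k' (s l))"
    and z: "\<And>r. r \<in> {1..q} \<Longrightarrow> val \<sigma> (z r) = int (Max (greedy_option w s l q ` {0..r}))"
    and b: "\<And>r. r \<in> {1..q} \<Longrightarrow>
      val \<sigma> (b r) = of_bool (Max (greedy_option w s l q ` {0..r - 1}) < greedy_option w s l q r)"
  shows "satisfies \<sigma> (max_chain M z b (\<lambda>k'. T (l - 1) (q - k') + Scale (int (w l)) (m k')) q)"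
proof -
  have c: "val \<sigma> (T (l - 1) (q - k') + Scale (int (w l)) (m k')) = int (greedy_option w s l q k')"
    if "k' \<le> q" for k'
  proof -
    have "q - k' \<le> K" "k' \<le> K"
      using q that by auto
    then show ?thesis
      using T[OF \<open>q - k' \<le> K\<close>] m[OF \<open>k' \<le> K\<close>] by (simp add: greedy_option_def)
  qed
  have Max_c: "Max ((\<lambda>k'. val \<sigma> (T (l - 1) (q - k') + Scale (int (w l)) (m k'))) ` {0..r}) =
      int (Max (greedy_option w s l q ` {0..r}))" if "r \<le> q" for r
  proof -
    have "(\<lambda>k'. val \<sigma> (T (l - 1) (q - k') + Scale (int (w l)) (m k'))) ` {0..r} =
        int ` greedy_option w s l q ` {0..r}"
      unfolding image_image using c that by (intro image_cong) auto
    moreover have "int (Max (greedy_option w s l q ` {0..r})) = Max (int ` greedy_option w s l q ` {0..r})"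
      by (rule int_Max) auto
    ultimately show ?thesis
      by (simp only:)
  qed
  show ?thesis
  proof (rule max_chainI)
    fix r assume r: "r \<in> {1..q}"
    then show "val \<sigma> (z r) =
        Max ((\<lambda>k'. val \<sigma> (T (l - 1) (q - k') + Scale (int (w l)) (m k'))) ` {0..r})"
      using z[OF r] Max_c[of r] by simp
    have "r - 1 \<le> q" "r \<le> q"
      using r by auto
    then show "val \<sigma> (b r) =
        of_bool (Max ((\<lambda>k'. val \<sigma> (T (l - 1) (q - k') + Scale (int (w l)) (m k'))) ` {0..r - 1})
          < val \<sigma> (T (l - 1) (q - r) + Scale (int (w l)) (m r)))"
      unfolding b[OF r] Max_c[OF \<open>r - 1 \<le> q\<close>] c[OF \<open>r \<le> q\<close>] by simp
  next
    fix k' assume k': "k' \<le> q"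
    have "greedy_option w s l q k' \<le> l * q"
      using greedy_option_le[OF assms(1)] l k' by simp
    also have "\<dots> \<le> L * K"
      using l q by (intro mult_mono) auto
    finally have "int (greedy_option w s l q k') \<le> M"
      using M by linarith
    then show "0 \<le> val \<sigma> (T (l - 1) (q - k') + Scale (int (w l)) (m k')) \<and>
        val \<sigma> (T (l - 1) (q - k') + Scale (int (w l)) (m k')) \<le> M"
      unfolding c[OF k'] by simp
  qed
qed

text \<open>The solution of the program given by the multiplicities \<open>x\<close>: all auxiliary variables get their
intended values, and a binary variable is \<open>0\<close> exactly if the first of the two compared numbers
is an optimum.\<close>

fun witness :: "nat \<Rightarrow> (nat multiset \<Rightarrow> nat) \<Rightarrow> ip_var \<Rightarrow> int" where
  "witness \<Delta> x (x_var \<pi>) = int (x \<pi>)"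
| "witness \<Delta> x (p_var i) = int ((\<Sum>\<pi>\<in>partitions_height \<Delta> i. count \<pi> i * x \<pi>) div 2)"
| "witness \<Delta> x (t_var i j l k) = int (greedy (\<lambda>r. r) (level_count \<Delta> x i j) l k)"
| "witness \<Delta> x (tt_var i l k) = int (greedy (\<lambda>r. min r k) (level_count \<Delta> x i i) l k)"
| "witness \<Delta> x (z_var (Min_s i j l k')) = int (min k' (level_count \<Delta> x i j l))"
| "witness \<Delta> x (b_var (Min_s i j l k')) = of_bool (level_count \<Delta> x i j l < k')"
| "witness \<Delta> x (z_var (Max_t i j l k m)) =
     int (Max (greedy_option (\<lambda>r. r) (level_count \<Delta> x i j) l k ` {0..m}))"
| "witness \<Delta> x (b_var (Max_t i j l k m)) =
     of_bool (Max (greedy_option (\<lambda>r. r) (level_count \<Delta> x i j) l k ` {0..m - 1})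
       < greedy_option (\<lambda>r. r) (level_count \<Delta> x i j) l k m)"
| "witness \<Delta> x (z_var (Max_tt i k l q m)) =
     int (Max (greedy_option (\<lambda>r. min r k) (level_count \<Delta> x i i) l q ` {0..m}))"
| "witness \<Delta> x (b_var (Max_tt i k l q m)) =
     of_bool (Max (greedy_option (\<lambda>r. min r k) (level_count \<Delta> x i i) l q ` {0..m - 1})
       < greedy_option (\<lambda>r. min r k) (level_count \<Delta> x i i) l q m)"

lemma val_class_sum:
  assumes "\<And>\<pi>. \<pi> \<in> partitions_height \<Delta> i \<Longrightarrow> \<sigma> (x_var \<pi>) = int (x \<pi>)"
  shows "val \<sigma> (\<Sum>\<pi>\<in>partitions_height \<Delta> i. Scale (int (g \<pi>)) (x_exp \<pi>)) =
    int (\<Sum>\<pi>\<in>partitions_height \<Delta> i. g \<pi> * x \<pi>)"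
  using assms by (simp add: x_exp_def)

lemma val_filter_sum:
  assumes "\<And>\<pi>. \<pi> \<in> partitions_height \<Delta> i \<Longrightarrow> \<sigma> (x_var \<pi>) = int (x \<pi>)"
  shows "val \<sigma> (\<Sum>\<pi> | \<pi> \<in> partitions_height \<Delta> i \<and> Q \<pi>. x_exp \<pi>) =
    int (\<Sum>\<pi> | \<pi> \<in> partitions_height \<Delta> i \<and> Q \<pi>. x \<pi>)"
  using assms by (simp add: x_exp_def)

lemma val_s_exp:
  assumes "\<And>\<pi>. \<pi> \<in> partitions_height \<Delta> i \<Longrightarrow> \<sigma> (x_var \<pi>) = int (x \<pi>)"
  shows "val \<sigma> (s_exp \<Delta> i j l) = int (level_count \<Delta> x i j l)"
  unfolding s_exp_def level_count_def by (rule val_filter_sum) (rule assms)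

text \<open>The program requires the variables \<open>x_var \<pi>\<close> to be nonnegative, so \<open>nat\<close> only changes the type of
their values.\<close>

lemma satisfies_imp_solves:
  assumes sat: "satisfies \<sigma> (snd (realization_ip M \<Delta> D F))"
  shows "solves \<Delta> D F (\<lambda>\<pi>. nat (\<sigma> (x_var \<pi>)))"
proof -
  define x where "x \<pi> = nat (\<sigma> (x_var \<pi>))" for \<pi>
  have sats: "satisfies \<sigma> (degree_constraints \<Delta> D F)" "satisfies \<sigma> (min_recursion_constraints M \<Delta>)"
    "satisfies \<sigma> (t_constraints M \<Delta>)" "satisfies \<sigma> (tt_constraints M \<Delta>)"
    "satisfies \<sigma> (gale_ryser_constraints \<Delta>)" "satisfies \<sigma> (erdos_gallai_constraints \<Delta>)"
    using sat by (simp_all add: realization_ip_def)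
  have "0 \<le> \<sigma> (x_var \<pi>)" if "\<pi> \<in> partitions \<Delta>" for \<pi>
    using sats(1) that by (auto simp: degree_constraints_def x_exp_def)
  then have x: "\<sigma> (x_var \<pi>) = int (x \<pi>)" if "\<pi> \<in> partitions_height \<Delta> i" for \<pi> i
    using that by (simp add: x_def partitions_height_def)
  have vals: "val \<sigma> (\<Sum>\<pi>\<in>partitions_height \<Delta> i. Scale (int (g \<pi>)) (x_exp \<pi>)) =
      int (\<Sum>\<pi>\<in>partitions_height \<Delta> i. g \<pi> * x \<pi>)" for i g
    by (rule val_class_sum) (rule x)
  have mins: "\<sigma> (z_var (Min_s i j l k')) = int (min k' (level_count \<Delta> x i j l))"
    if "1 \<le> i" "i \<le> j" "j \<le> \<Delta>" "l \<in> {1..\<Delta>}" "k' \<le> \<Delta>" for i j l k'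
  proof -
    have "satisfies \<sigma> (min_constraints M (Z (Min_s i j l k')) (B (Min_s i j l k')) (Const (int k')) (s_exp \<Delta> i j l))"
      using sats(2) that by (auto simp: min_recursion_constraints_def)
    from satisfies_min_constraints[OF this] show ?thesis
      using val_s_exp[of \<Delta> i \<sigma> x j l] x by simp
  qed
  have t: "val \<sigma> (t_exp i j l k) = int (greedy (\<lambda>r. r) (level_count \<Delta> x i j) l k)"
    if "1 \<le> i" "i \<le> j" "j \<le> \<Delta>" "l \<le> \<Delta>" "k \<le> \<Delta>" for i j l k
  proof (rule greedy_recursion_sound[where T = "t_exp i j" and L = \<Delta> and K = \<Delta>])
    show "val \<sigma> (Z (Min_s i j l k')) = int (min k' (level_count \<Delta> x i j l))"
      if "l \<in> {1..\<Delta>}" "k' \<le> \<Delta>" for l k'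
      using mins \<open>1 \<le> i\<close> \<open>i \<le> j\<close> \<open>j \<le> \<Delta>\<close> that by simp
    fix l q assume lq: "l \<in> {1..\<Delta>}" "q \<in> {1..\<Delta>}"
    have "satisfies \<sigma> (max_chain M (\<lambda>m. Z (Max_t i j l q m)) (\<lambda>m. B (Max_t i j l q m))
          (\<lambda>k'. t_exp i j (l - 1) (q - k') + Scale (int l) (Z (Min_s i j l k'))) q \<union>
        equ (t_exp i j l q) (Z (Max_t i j l q q)))"
      using sats(3) lq that unfolding t_constraints_def satisfies_simps(4) by fastforce
    then show "satisfies \<sigma> (max_chain M (\<lambda>m. Z (Max_t i j l q m)) (\<lambda>m. B (Max_t i j l q m))
          (\<lambda>k'. t_exp i j (l - 1) (q - k') + Scale (int l) (Z (Min_s i j l k'))) q)"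
      and "val \<sigma> (t_exp i j l q) = val \<sigma> (Z (Max_t i j l q q))"
      by simp_all
  qed (use that in \<open>simp_all add: t_exp_def\<close>)
  have tt: "val \<sigma> (tt_run i k l q) = int (greedy (\<lambda>r. min r k) (level_count \<Delta> x i i) l q)"
    if "i \<in> {1..\<Delta>}" "k \<in> {1..\<Delta>}" "l \<le> \<Delta>" "q \<le> k" for i k l q
  proof (rule greedy_recursion_sound[where T = "tt_run i k" and L = \<Delta> and K = k])
    show "val \<sigma> (Z (Min_s i i l k')) = int (min k' (level_count \<Delta> x i i l))"
      if "l \<in> {1..\<Delta>}" "k' \<le> k" for l k'
      using mins[of i i l k'] \<open>i \<in> {1..\<Delta>}\<close> \<open>k \<in> {1..\<Delta>}\<close> that by simp
    fix l q assume lq: "l \<in> {1..\<Delta>}" "q \<in> {1..k}"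
    have "satisfies \<sigma> (max_chain M (\<lambda>m. Z (Max_tt i k l q m)) (\<lambda>m. B (Max_tt i k l q m))
          (\<lambda>k'. tt_run i k (l - 1) (q - k') + Scale (int (min l k)) (Z (Min_s i i l k'))) q \<union>
        equ (tt_run i k l q) (Z (Max_tt i k l q q)))"
      using sats(4) lq that unfolding tt_constraints_def satisfies_simps(4) by blast
    then show "satisfies \<sigma> (max_chain M (\<lambda>m. Z (Max_tt i k l q m)) (\<lambda>m. B (Max_tt i k l q m))
          (\<lambda>k'. tt_run i k (l - 1) (q - k') + Scale (int (min l k)) (Z (Min_s i i l k'))) q)"
      and "val \<sigma> (tt_run i k l q) = val \<sigma> (Z (Max_tt i k l q q))"
      by simp_all
  qed (use that in \<open>simp_all add: tt_run_def\<close>)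
  have "solves \<Delta> D F x"
    unfolding solves_def
  proof (intro conjI allI ballI)
    fix d f
    have "val \<sigma> (\<Sum>\<pi> | \<pi> \<in> partitions_height \<Delta> d \<and> sum_mset \<pi> = f. x_exp \<pi>) =
        int (card {i. i < length D \<and> D ! i = d \<and> F ! i = f})"
      using sats(1) by (simp add: degree_constraints_def)
    then show "(\<Sum>\<pi> | \<pi> \<in> partitions_height \<Delta> d \<and> sum_mset \<pi> = f. x \<pi>) =
        card {i. i < length D \<and> D ! i = d \<and> F ! i = f}"
      using val_filter_sum[of \<Delta> d \<sigma> x "\<lambda>\<pi>. sum_mset \<pi> = f"] x by (simp only: of_nat_eq_iff)
  next
    fix i j assume ij: "j \<in> {1..\<Delta>}" "i \<in> {1..<j}"
    have *: "satisfies \<sigma> (equ (\<Sum>\<mu>\<in>partitions_height \<Delta> i. Scale (int (count \<mu> j)) (x_exp \<mu>))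
            (\<Sum>\<mu>\<in>partitions_height \<Delta> j. Scale (int (count \<mu> i)) (x_exp \<mu>)) \<union>
        (\<Union>k\<in>{1..\<Delta> - 1}.
           {leq (t_exp i j i k)
                (\<Sum>\<mu>\<in>partitions_height \<Delta> j. Scale (int (min k (count \<mu> i))) (x_exp \<mu>))}))"
      using sats(5) ij unfolding gale_ryser_constraints_def satisfies_simps(4) by blast
    then show "(\<Sum>\<pi>\<in>partitions_height \<Delta> i. count \<pi> j * x \<pi>) =
        (\<Sum>\<pi>\<in>partitions_height \<Delta> j. count \<pi> i * x \<pi>)"
      unfolding satisfies_simps satisfies_equ vals of_nat_eq_iff by blast
    fix k assume k: "k \<in> {1..\<Delta> - 1}"
    have "val \<sigma> (t_exp i j i k) \<le>
        int (\<Sum>\<pi>\<in>partitions_height \<Delta> j. min k (count \<pi> i) * x \<pi>)"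
      using * k unfolding satisfies_simps satisfies_equ vals by blast
    moreover have "val \<sigma> (t_exp i j i k) = int (greedy (\<lambda>r. r) (level_count \<Delta> x i j) i k)"
    proof (rule t)
      show "k \<le> \<Delta>" using k by auto
    qed (use ij in auto)
    ultimately show "greedy (\<lambda>r. r) (level_count \<Delta> x i j) i k \<le>
        (\<Sum>\<pi>\<in>partitions_height \<Delta> j. min k (count \<pi> i) * x \<pi>)"
      by (simp only: of_nat_le_iff)
  next
    fix i assume i: "i \<in> {1..\<Delta>}"
    have *: "satisfies \<sigma> (equ (\<Sum>\<mu>\<in>partitions_height \<Delta> i. Scale (int (count \<mu> i)) (x_exp \<mu>))
            (Scale 2 (Var (p_var i))) \<union>
        (\<Union>k\<in>{1..\<Delta>}.
           {leq (t_exp i i i k)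
                (Const (int k * (int k - 1)) +
                 (\<Sum>\<mu>\<in>partitions_height \<Delta> i. Scale (int (min k (count \<mu> i))) (x_exp \<mu>)) -
                 tt_exp i i k)}))"
      using sats(6) i unfolding erdos_gallai_constraints_def satisfies_simps(4) by blast
    then have "int (\<Sum>\<pi>\<in>partitions_height \<Delta> i. count \<pi> i * x \<pi>) = 2 * \<sigma> (p_var i)"
      unfolding satisfies_simps satisfies_equ vals val_Scale val_Var by blast
    then show "even (\<Sum>\<pi>\<in>partitions_height \<Delta> i. count \<pi> i * x \<pi>)"
      by (metis dvd_triv_left even_of_nat)
    fix k assume k: "k \<in> {1..\<Delta>}"
    have "val \<sigma> (t_exp i i i k) \<le> int k * (int k - 1) +
        int (\<Sum>\<pi>\<in>partitions_height \<Delta> i. min k (count \<pi> i) * x \<pi>) - val \<sigma> (tt_exp i i k)"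
      using * k unfolding satisfies_simps satisfies_equ val_diff val_add val_Const vals by blast
    moreover have "val \<sigma> (t_exp i i i k) = int (greedy (\<lambda>r. r) (level_count \<Delta> x i i) i k)"
      using t[of i i i k] i k by simp
    moreover have "val \<sigma> (tt_exp i i k) = int (greedy (\<lambda>r. min r k) (level_count \<Delta> x i i) i k)"
      using tt[of i k i k] i k by (simp add: tt_run_def)
    moreover have "int k * (int k - 1) = int (k * (k - 1))"
      using k by (simp add: of_nat_diff)
    ultimately have "int (greedy (\<lambda>r. r) (level_count \<Delta> x i i) i k +
        greedy (\<lambda>r. min r k) (level_count \<Delta> x i i) i k)
        \<le> int (k * (k - 1) + (\<Sum>\<pi>\<in>partitions_height \<Delta> i. min k (count \<pi> i) * x \<pi>))"
      unfolding of_nat_add by linarith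
    then show "greedy (\<lambda>r. r) (level_count \<Delta> x i i) i k +
        greedy (\<lambda>r. min r k) (level_count \<Delta> x i i) i k
        \<le> k * (k - 1) + (\<Sum>\<pi>\<in>partitions_height \<Delta> i. min k (count \<pi> i) * x \<pi>)"
      by (simp only: of_nat_le_iff)
  qed
  then show ?thesis
    by (simp add: x_def[abs_def])
qed

text \<open>The compared numbers are \<open>k' \<le> \<Delta>\<close> and \<open>s \<le> length D\<close> in the minima, and \<open>greedy\<close> values of at most
\<open>\<Delta> * \<Delta>\<close> in the maxima; this is where the lower bound on \<open>M\<close> enters.\<close>

lemma solves_imp_satisfies:
  assumes sol: "solves \<Delta> D F x" and M: "M \<ge> int (length D) + (int \<Delta>)\<^sup>2"
  shows "satisfies (witness \<Delta> x) (snd (realization_ip M \<Delta> D F))"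
proof -
  let ?\<sigma> = "witness \<Delta> x"
  have x: "?\<sigma> (x_var \<pi>) = int (x \<pi>)" for \<pi>
    by simp
  note vals = val_class_sum[where \<sigma> = ?\<sigma> and x = x, OF x]
  note vals' = val_filter_sum[where \<sigma> = ?\<sigma> and x = x, OF x]
  have square: "int (\<Delta> * \<Delta>) \<le> M"
    using M by (simp add: power2_eq_square)
  have t: "val ?\<sigma> (t_exp i j l k) = int (greedy (\<lambda>r. r) (level_count \<Delta> x i j) l k)" for i j l k
    by (simp add: t_exp_def)
  \<comment> \<open>For \<open>q < k\<close> the value of the run is the last maximum of its chain, not a recursion variable.\<close>
  have tt: "val ?\<sigma> (tt_run i k l q) = int (greedy (\<lambda>r. min r k) (level_count \<Delta> x i i) l q)" for i k l q
  proof (cases "l = 0 \<or> q = 0 \<or> q = k")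
    case True
    then show ?thesis by (auto simp: tt_run_def tt_exp_def)
  next
    case False
    then show ?thesis by (auto simp: tt_run_def greedy_eq_Max_option)
  qed
  have "satisfies ?\<sigma> (degree_constraints \<Delta> D F)"
    unfolding degree_constraints_def satisfies_simps satisfies_equ vals' val_Const of_nat_eq_iff
    using sol by (simp add: solves_def x_exp_def)
  moreover have "satisfies ?\<sigma> (min_recursion_constraints M \<Delta>)"
    unfolding min_recursion_constraints_def satisfies_simps
  proof (intro ballI min_constraintsI; unfold val_s_exp[where \<sigma> = ?\<sigma> and x = x, OF x] val_Const val_Var)
    fix i j l k' assume "k' \<in> {0..\<Delta>}"
    then have "int k' \<le> (int \<Delta>)\<^sup>2"
      by (metis atLeastAtMost_iff of_nat_mono of_nat_power order_trans power2_nat_le_imp_le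
          self_le_ge2_pow le_square power2_eq_square)
    then show "\<bar>int k' - int (level_count \<Delta> x i j l)\<bar> \<le> M"
      using M level_count_le[OF sol, of i j l] by linarith
  qed simp_all
  moreover have "satisfies ?\<sigma> (t_constraints M \<Delta>)"
    unfolding t_constraints_def satisfies_simps(3,4) satisfies_equ
  proof (intro ballI conjI)
    fix i j l k assume lk: "l \<in> {1..\<Delta>}" "k \<in> {1..\<Delta>}"
    show "satisfies ?\<sigma> (max_chain M (\<lambda>m. Z (Max_t i j l k m)) (\<lambda>m. B (Max_t i j l k m))
          (\<lambda>k'. t_exp i j (l - 1) (k - k') + Scale (int l) (Z (Min_s i j l k'))) k)"
      by (rule greedy_recursion_complete[where T = "t_exp i j" and w = "\<lambda>r. r" and
            s = "level_count \<Delta> x i j", OF _ square lk t]) simp_all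
    show "val ?\<sigma> (t_exp i j l k) = val ?\<sigma> (Z (Max_t i j l k k))"
      using lk by (simp add: t greedy_eq_Max_option)
  qed
  moreover have "satisfies ?\<sigma> (tt_constraints M \<Delta>)"
    unfolding tt_constraints_def satisfies_simps(3,4) satisfies_equ
  proof (intro ballI conjI)
    fix i k l q assume k: "k \<in> {1..\<Delta>}" and l: "l \<in> {1..\<Delta>}" and q: "q \<in> {1..k}"
    then have q': "q \<in> {1..\<Delta>}" by auto
    show "satisfies ?\<sigma> (max_chain M (\<lambda>m. Z (Max_tt i k l q m)) (\<lambda>m. B (Max_tt i k l q m))
          (\<lambda>k'. tt_run i k (l - 1) (q - k') + Scale (int (min l k)) (Z (Min_s i i l k'))) q)"
      by (rule greedy_recursion_complete[where T = "tt_run i k" and w = "\<lambda>r. min r k" and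
            s = "level_count \<Delta> x i i", OF _ square l q' tt]) simp_all
    show "val ?\<sigma> (tt_run i k l q) = val ?\<sigma> (Z (Max_tt i k l q q))"
      using l by (simp add: tt greedy_eq_Max_option)
  qed
  moreover have "satisfies ?\<sigma> (gale_ryser_constraints \<Delta>)"
    unfolding gale_ryser_constraints_def satisfies_simps satisfies_equ vals t of_nat_eq_iff of_nat_le_iff
    using sol satisfies_simps(1)[of ?\<sigma>] unfolding solves_def by blast
  moreover have "satisfies ?\<sigma> (erdos_gallai_constraints \<Delta>)"
    unfolding erdos_gallai_constraints_def satisfies_simps satisfies_equ vals t val_diff val_add
      val_Scale val_Var val_Const
  proof (intro ballI conjI satisfies_simps(1))
    fix i assume i: "i \<in> {1..\<Delta>}"
    then have "even (\<Sum>\<pi>\<in>partitions_height \<Delta> i. count \<pi> i * x \<pi>)"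
      using sol by (simp add: solves_def)
    then show "int (\<Sum>\<pi>\<in>partitions_height \<Delta> i. count \<pi> i * x \<pi>) = 2 * ?\<sigma> (p_var i)"
      unfolding witness.simps by presburger
    fix k assume k: "k \<in> {1..\<Delta>}"
    have "greedy (\<lambda>r. r) (level_count \<Delta> x i i) i k +
        greedy (\<lambda>r. min r k) (level_count \<Delta> x i i) i k
        \<le> k * (k - 1) + (\<Sum>\<pi>\<in>partitions_height \<Delta> i. min k (count \<pi> i) * x \<pi>)"
      using sol i k unfolding solves_def by blast
    moreover have "val ?\<sigma> (tt_exp i i k) = int (greedy (\<lambda>r. min r k) (level_count \<Delta> x i i) i k)"
      using tt[of i k i k] i k by (simp add: tt_run_def)
    moreover have "int k * (int k - 1) = int (k * (k - 1))"
      using k by (simp add: of_nat_diff)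
    ultimately show "int (greedy (\<lambda>r. r) (level_count \<Delta> x i i) i k) \<le> int k * (int k - 1) +
        int (\<Sum>\<pi>\<in>partitions_height \<Delta> i. min k (count \<pi> i) * x \<pi>) - val ?\<sigma> (tt_exp i i k)"
      by linarith
  qed
  ultimately show ?thesis
    by (simp add: realization_ip_def)
qed

section \<open>Well-formedness and size of the program\<close>

text \<open>Syntactic counterparts of \<open>val\<close> and \<open>satisfies\<close>: only variables in \<open>X\<close> have nonzero coefficients.\<close>

definition exp_over :: "'v set \<Rightarrow> 'v lin_exp \<Rightarrow> bool" where
  "exp_over X e \<longleftrightarrow> Poly_Mapping.keys (fst e) \<subseteq> X"

definition system_over :: "'v set \<Rightarrow> 'v lin_ineq set \<Rightarrow> bool" where
  "system_over X L \<longleftrightarrow> (\<forall>(a, c)\<in>L. Poly_Mapping.keys a \<subseteq> X)"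

lemma exp_over_Var [simp]: "exp_over X (Var v) \<longleftrightarrow> v \<in> X"
  by (simp add: exp_over_def Var_def)

lemma exp_over_Const [simp]: "exp_over X (Const c)"
  by (simp add: exp_over_def Const_def)

lemma exp_over_add [intro]: "exp_over X e \<Longrightarrow> exp_over X e' \<Longrightarrow> exp_over X (e + e')"
  unfolding exp_over_def fst_add using Poly_Mapping.keys_add[of "fst e" "fst e'"] by blast

lemma exp_over_diff [intro]: "exp_over X e \<Longrightarrow> exp_over X e' \<Longrightarrow> exp_over X (e - e')"
  unfolding exp_over_def fst_diff using keys_diff[of "fst e" "fst e'"] by blast

lemma exp_over_Scale [intro]: "exp_over X e \<Longrightarrow> exp_over X (Scale c e)"
  unfolding exp_over_def Scale_def using keys_cmul[of c "fst e"] by auto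

lemma exp_over_sum [intro]:
  assumes "\<And>i. i \<in> I \<Longrightarrow> exp_over X (g i)"
  shows "exp_over X (\<Sum>i\<in>I. g i)"
  using assms
proof (induction I rule: infinite_finite_induct)
  case (insert i I)
  then show ?case by (simp add: exp_over_add)
qed (simp_all add: exp_over_def)

lemma system_over_simps [simp]:
  "system_over X {}"
  "system_over X (L \<union> L') \<longleftrightarrow> system_over X L \<and> system_over X L'"
  "system_over X (\<Union>i\<in>I. K i) \<longleftrightarrow> (\<forall>i\<in>I. system_over X (K i))"
  by (auto simp: system_over_def)

lemma system_over_leq [intro]:
  assumes "exp_over X e" "exp_over X e'" "system_over X L"
  shows "system_over X (insert (leq e e') L)"
proof -
  have "exp_over X (e - e')"
    using assms by blast
  then show ?thesis
    using assms(3) by (simp add: system_over_def exp_over_def leq_def)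
qed

lemma system_over_equ [intro]: "exp_over X e \<Longrightarrow> exp_over X e' \<Longrightarrow> system_over X (equ e e')"
  unfolding equ_def by (intro system_over_leq system_over_simps)

lemma system_over_min_constraints [intro]:
  assumes "exp_over X z" "exp_over X b" "exp_over X x" "exp_over X y"
  shows "system_over X (min_constraints M z b x y)"
  unfolding min_constraints_def
  by (intro system_over_leq system_over_simps exp_over_diff exp_over_Scale exp_over_Const assms)

lemma system_over_max_chain [intro]:
  assumes "\<And>m. m \<in> {1..k} \<Longrightarrow> exp_over X (z m)" "\<And>m. m \<in> {1..k} \<Longrightarrow> exp_over X (b m)"
    "\<And>k'. k' \<le> k \<Longrightarrow> exp_over X (c k')"
  shows "system_over X (max_chain M z b c k)"
  unfolding max_chain_def system_over_simps
proof
  fix m assume m: "m \<in> {1..k}"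
  have "exp_over X (if m = 1 then c 0 else z (m - 1))"
    using assms(1)[of "m - 1"] assms(3)[of 0] m by (cases "m = 1") (auto simp: Suc_le_eq)
  moreover have "exp_over X (c m)"
    using assms(3) m by simp
  ultimately show "system_over X (max_constraints M (z m) (b m) (if m = 1 then c 0 else z (m - 1)) (c m))"
    unfolding max_constraints_def
    by (intro system_over_leq system_over_simps exp_over_add exp_over_diff exp_over_Scale
        exp_over_Const assms(1)[OF m] assms(2)[OF m])
qed

text \<open>A name has at most five indices, each of them at most \<open>\<Delta>\<close>.\<close>

lemma aux_names_bound: "finite (aux_names \<Delta>) \<and> card (aux_names \<Delta>) \<le> 3 * (\<Delta> + 1) ^ 5"
proof -
  let ?I = "{..\<Delta>}"
  let ?A = "(\<lambda>(i, j, l, k). Min_s i j l k) ` (?I \<times> ?I \<times> ?I \<times> ?I)"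
  let ?B = "(\<lambda>(i, j, l, k, m). Max_t i j l k m) ` (?I \<times> ?I \<times> ?I \<times> ?I \<times> ?I)"
  let ?C = "(\<lambda>(i, k, l, q, m). Max_tt i k l q m) ` (?I \<times> ?I \<times> ?I \<times> ?I \<times> ?I)"
  have sub: "aux_names \<Delta> \<subseteq> ?A \<union> ?B \<union> ?C"
  proof
    fix a assume "a \<in> aux_names \<Delta>"
    then show "a \<in> ?A \<union> ?B \<union> ?C"
      by (cases a) (auto simp: aux_names_def image_iff)
  qed
  have fin: "finite (?A \<union> ?B \<union> ?C)" by blast
  have A: "card ?A \<le> (\<Delta> + 1) ^ 4"
    by (rule order_trans[OF card_image_le]) (auto simp: card_cartesian_product power4_eq_xxxx)
  have BC: "card ?B \<le> (\<Delta> + 1) ^ 5" "card ?C \<le> (\<Delta> + 1) ^ 5"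
    by (rule order_trans[OF card_image_le],
        auto simp: card_cartesian_product eval_nat_numeral)+
  have "card (aux_names \<Delta>) \<le> card (?A \<union> ?B \<union> ?C)"
    using fin sub by (rule card_mono)
  also have "\<dots> \<le> card ?A + card ?B + card ?C"
    by (meson add_le_cancel_right card_Un_le order_trans)
  also have "\<dots> \<le> (\<Delta> + 1) ^ 5 + (\<Delta> + 1) ^ 5 + (\<Delta> + 1) ^ 5"
    using A BC power_increasing[of 4 5 "\<Delta> + 1"] by linarith
  finally have "card (aux_names \<Delta>) \<le> 3 * (\<Delta> + 1) ^ 5" by simp
  then show ?thesis
    using finite_subset[OF sub fin] by simp
qed

lemma finite_ip_vars: "finite (ip_vars \<Delta>)"
proof -
  let ?I = "{..\<Delta>}"
  have "finite {t_var i j l k | i j l k. 1 \<le> i \<and> i \<le> j \<and> j \<le> \<Delta> \<and> l \<in> {1..\<Delta>} \<and> k \<in> {1..\<Delta>}}"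
    by (rule finite_subset[of _ "(\<lambda>(i, j, l, k). t_var i j l k) ` (?I \<times> ?I \<times> ?I \<times> ?I)"])
      (auto simp: image_iff)
  moreover have "finite {tt_var i l k | i l k. i \<in> {1..\<Delta>} \<and> l \<in> {1..\<Delta>} \<and> k \<in> {1..\<Delta>}}"
    by (rule finite_subset[of _ "(\<lambda>(i, l, k). tt_var i l k) ` (?I \<times> ?I \<times> ?I)"])
      (auto simp: image_iff)
  ultimately show ?thesis
    using aux_names_bound finite_partitions by (simp add: ip_vars_def)
qed

lemma card_aux_names_bigo: "(\<lambda>m. real (card (aux_names m))) \<in> O(\<lambda>m. real m ^ 5)"
proof (rule bigoI)
  show "\<forall>\<^sub>F m in sequentially. norm (real (card (aux_names m))) \<le> 96 * norm (real m ^ 5)"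
    using eventually_ge_at_top[of 1]
  proof eventually_elim
    case (elim m)
    have "card (aux_names m) \<le> 3 * (m + 1) ^ 5"
      using aux_names_bound by blast
    also have "\<dots> \<le> 3 * (2 * m) ^ 5"
      using elim by (intro mult_left_mono power_mono) auto
    also have "\<dots> = 96 * m ^ 5"
      by (simp add: power_mult_distrib)
    finally have "real (card (aux_names m)) \<le> real (96 * m ^ 5)"
      by (rule of_nat_mono)
    then show ?case by simp
  qed
qed

text \<open>Although \<open>d\<close> and \<open>f\<close> range over all natural numbers, an equation is determined by its set of
partitions and its right-hand side, and there are only finitely many of both.\<close>

lemma finite_degree_constraints: "finite (degree_constraints \<Delta> D F)"
proof -
  let ?rows = "\<lambda>(S, c). equ (\<Sum>\<mu>\<in>S. x_exp \<mu>) (Const (int c))"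
  have "(\<Union>d. \<Union>f. equ (\<Sum>\<mu> | \<mu> \<in> partitions_height \<Delta> d \<and> sum_mset \<mu> = f. x_exp \<mu>)
                 (Const (int (card {i. i < length D \<and> D ! i = d \<and> F ! i = f}))))
      \<subseteq> (\<Union>p\<in>Pow (partitions \<Delta>) \<times> {..length D}. ?rows p)"
  proof (intro UN_least)
    fix d f
    have "card {i. i < length D \<and> D ! i = d \<and> F ! i = f} \<le> card {..<length D}"
      by (intro card_mono) auto
    then have "({\<mu>. \<mu> \<in> partitions_height \<Delta> d \<and> sum_mset \<mu> = f},
        card {i. i < length D \<and> D ! i = d \<and> F ! i = f}) \<in> Pow (partitions \<Delta>) \<times> {..length D}"
      by (auto simp: partitions_height_def)
    then show "equ (\<Sum>\<mu> | \<mu> \<in> partitions_height \<Delta> d \<and> sum_mset \<mu> = f. x_exp \<mu>)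
                 (Const (int (card {i. i < length D \<and> D ! i = d \<and> F ! i = f})))
      \<subseteq> (\<Union>p\<in>Pow (partitions \<Delta>) \<times> {..length D}. ?rows p)"
      by (intro subsetI, rule UN_I) simp_all
  qed
  moreover have "finite (\<Union>p\<in>Pow (partitions \<Delta>) \<times> {..length D}. ?rows p)"
    using finite_partitions by (auto simp: equ_def)
  ultimately have "finite (\<Union>d. \<Union>f.
      equ (\<Sum>\<mu> | \<mu> \<in> partitions_height \<Delta> d \<and> sum_mset \<mu> = f. x_exp \<mu>)
        (Const (int (card {i. i < length D \<and> D ! i = d \<and> F ! i = f}))))"
    by (rule finite_subset)
  then show ?thesis
    unfolding degree_constraints_def by (rule finite_UnI) (simp add: finite_partitions)
qed

lemma ip_problem_realization_ip: "ip_problem (realization_ip M \<Delta> D F)"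
proof -
  let ?X = "ip_vars \<Delta>"
  have x: "exp_over ?X (x_exp \<mu>)" if "\<mu> \<in> partitions_height \<Delta> i" for \<mu> i
    using that by (simp add: x_exp_def ip_vars_def partitions_height_def)
  have x_sum: "exp_over ?X (\<Sum>\<mu>\<in>partitions_height \<Delta> i. Scale (g \<mu>) (x_exp \<mu>))" for i g
    using x by blast
  have zb: "exp_over ?X (Z a)" "exp_over ?X (B a)" if "a \<in> aux_names \<Delta>" for a
    using that by (simp_all add: ip_vars_def)
  have t: "exp_over ?X (t_exp i j l k)"
    if "1 \<le> i" "i \<le> j" "j \<le> \<Delta>" "l \<le> \<Delta>" "k \<le> \<Delta>" for i j l k
    using that by (auto simp: t_exp_def ip_vars_def)
  have tt: "exp_over ?X (tt_exp i l k)" if "i \<in> {1..\<Delta>}" "l \<le> \<Delta>" "k \<le> \<Delta>" for i l k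
    using that by (auto simp: tt_exp_def ip_vars_def)
  have tt_run: "exp_over ?X (tt_run i k l q)"
    if "i \<in> {1..\<Delta>}" "k \<in> {1..\<Delta>}" "l \<le> \<Delta>" "q \<le> k" for i k l q
    using that tt[of i l k] zb(1)[of "Max_tt i k l q q"] by (auto simp: tt_run_def aux_names_def)
  have mins: "Min_s i j l k' \<in> aux_names \<Delta>"
    if "1 \<le> i" "i \<le> j" "j \<le> \<Delta>" "l \<in> {1..\<Delta>}" "k' \<le> \<Delta>" for i j l k'
    using that by (auto simp: aux_names_def)
  have "system_over ?X (degree_constraints \<Delta> D F)"
    unfolding degree_constraints_def system_over_simps
    by (intro conjI ballI system_over_equ system_over_leq exp_over_sum exp_over_Const system_over_simps)
      (auto simp: x_exp_def ip_vars_def partitions_height_def)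
  moreover have "system_over ?X (min_recursion_constraints M \<Delta>)"
    unfolding min_recursion_constraints_def system_over_simps
  proof (intro ballI system_over_min_constraints exp_over_Const zb mins)
    show "exp_over ?X (s_exp \<Delta> i j l)" for i j l
      unfolding s_exp_def using x by blast
  qed auto
  moreover have "system_over ?X (t_constraints M \<Delta>)"
    unfolding t_constraints_def system_over_simps
    by (intro ballI conjI system_over_equ system_over_max_chain exp_over_add exp_over_Scale zb t mins)
      (auto simp: aux_names_def)
  moreover have "system_over ?X (tt_constraints M \<Delta>)"
    unfolding tt_constraints_def system_over_simps
    by (intro ballI conjI system_over_equ system_over_max_chain exp_over_add exp_over_Scale zb tt_run mins)
      (auto simp: aux_names_def)
  moreover have "system_over ?X (gale_ryser_constraints \<Delta>)"
    unfolding gale_ryser_constraints_def system_over_simps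
    by (intro ballI conjI system_over_equ system_over_leq system_over_simps x_sum t) auto
  moreover have "system_over ?X (erdos_gallai_constraints \<Delta>)"
    unfolding erdos_gallai_constraints_def system_over_simps
    by (intro ballI conjI system_over_equ system_over_leq system_over_simps exp_over_add
        exp_over_diff exp_over_Scale exp_over_Const x_sum t tt) (auto simp: ip_vars_def)
  ultimately have "system_over ?X (snd (realization_ip M \<Delta> D F))"
    by (simp add: realization_ip_def)
  moreover have "finite (snd (realization_ip M \<Delta> D F))"
    using finite_degree_constraints
    by (simp add: realization_ip_def min_recursion_constraints_def t_constraints_def
        tt_constraints_def gale_ryser_constraints_def erdos_gallai_constraints_def
        min_constraints_def max_chain_def max_constraints_def equ_def)
  ultimately show ?thesis
    using finite_ip_vars by (simp add: ip_problem_def system_over_def realization_ip_def)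
qed

theorem theorem20:
  fixes D F :: "nat list" and \<Delta> :: nat and M :: int
  assumes "D \<noteq> []" and "length F = length D"
    and "\<forall>d\<in>set D. d > 0" and "\<forall>f\<in>set F. f > 0"
    and "\<Delta> = Max (set D)"
    and "M \<ge> int (length D) + (int \<Delta>)\<^sup>2"
  shows "ip_problem (realization_ip M \<Delta> D F) \<and>
    (simple_graph_realizable D F \<longleftrightarrow> ip_feasible (realization_ip M \<Delta> D F)) \<and>
    (\<lambda>m. real (card (aux_names m))) \<in> O(\<lambda>m. real m ^ 5)"
proof (intro conjI ip_problem_realization_ip card_aux_names_bigo)
  have "D ! v \<in> {1..\<Delta>}" if "v < length D" for v
    using that assms(3,5) by (auto simp: Suc_le_eq)
  then have "simple_graph_realizable D F \<longleftrightarrow> (\<exists>x. solves \<Delta> D F x)"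
    by (rule realizable_iff_solves)
  also have "\<dots> \<longleftrightarrow> ip_feasible (realization_ip M \<Delta> D F)"
    unfolding ip_feasible_iff_satisfies[OF ip_problem_realization_ip]
    using satisfies_imp_solves solves_imp_satisfies[OF _ assms(6)] by blast
  finally show "simple_graph_realizable D F \<longleftrightarrow> ip_feasible (realization_ip M \<Delta> D F)" .
qed

end
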